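(* For every 2D SLP $G$ of size $|G|=g$ representing a 2D string $T\in\Sigma^{r\times c}$, there exists a data structure of size $\mathcal{O}(g\log^2 n)$, where $n=\max(r,c)$, that, given any $(i,j)\in[1..r]\times[1..c]$, returns $T[i,j]$ in $\mathcal{O}(\log n)$ time.
   Context: A 2D SLP is a tuple $G=(V_l,V_h,V_v,\Sigma,R,S)$ where $V_l$ (nonempty), $V_h$, $V_v$, $\Sigma$ are pairwise disjoint finite sets (literal, horizontal, vertical nonterminals, terminals), $V=V_l\cup V_h\cup V_v$, $S\in V$. Each $N\in V$ has exactly one rule $N\to\mathrm{rhs}(N)$: $\mathrm{rhs}(N)\in\Sigma$ for $N\in V_l$, and $\mathrm{rhs}(N)=AB$ with $A,B\in V$ for $N\in V_h\cup V_v$; there is an ordering $N_1,\dots,N_{|V|}$ of $V$ such that $\mathrm{rhs}(N_i)$ for $N_i\in V_h\cup V_v$ uses only $N_j$ with $j>i$. Expansions: for $N\in V_l$, the $1\times1$ matrix containing $\mathrm{rhs}(N)$; for $N\in V_h$ with $\mathrm{rhs}(N)=AB$ (equal numbers of columns required), $\mathrm{exp}(A)$ placed on top of $\mathrm{exp}(B)$; for $N\in V_v$ with $\mathrm{rhs}(N)=AB$ (equal numbers of rows required), $\mathrm{exp}(A)$ placed to the left of $\mathrm{exp}(B)$. $G$ represents $T=\mathrm{exp}(S)$. Size: $|G|=\sum_{N\in V}\max(|\mathrm{rhs}(N)|,1)$. Space in machine words, time in word-RAM operations. *)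

theory Defs
  imports Complex_Main
begin

section \<open>Two-dimensional straight-line programs\<close>

record 's slp2d =
  lits  :: "'s set"
  hors  :: "'s set"
  vers  :: "'s set"
  sigma :: "'s set"
  rhs   :: "'s \<Rightarrow> 's list"
  start :: "'s"

definition nonterms :: "'s slp2d \<Rightarrow> 's set" where
  "nonterms G = lits G \<union> hors G \<union> vers G"

text \<open>A 2D string is the list of its rows, from top to bottom.\<close>

definition strings2d :: "'s set \<Rightarrow> nat \<Rightarrow> nat \<Rightarrow> 's list list set" where
  "strings2d \<Sigma> r c = {T. length T = r \<and> (\<forall>row \<in> set T. length row = c \<and> set row \<subseteq> \<Sigma>)}"

definition access2d :: "'s list list \<Rightarrow> nat \<Rightarrow> nat \<Rightarrow> 's" where
  "access2d T i j = T ! (i - 1) ! (j - 1)"  \<comment> \<open>indices start at 1\<close>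

definition nrows :: "'s list list \<Rightarrow> nat" where
  "nrows M = length M"

definition ncols :: "'s list list \<Rightarrow> nat" where
  "ncols M = length (hd M)"

text \<open>The dimension requirements on the concatenations are imposed in \<open>is_slp2d\<close> below.\<close>

inductive expands :: "'s slp2d \<Rightarrow> 's \<Rightarrow> 's list list \<Rightarrow> bool" for G where
  lit: "N \<in> lits G \<Longrightarrow> rhs G N = [a] \<Longrightarrow> expands G N [[a]]"
| hor: "N \<in> hors G \<Longrightarrow> rhs G N = [A, B] \<Longrightarrow> expands G A M \<Longrightarrow> expands G B M'
        \<Longrightarrow> expands G N (M @ M')"
| ver: "N \<in> vers G \<Longrightarrow> rhs G N = [A, B] \<Longrightarrow> expands G A M \<Longrightarrow> expands G B M'
        \<Longrightarrow> expands G N (map2 (@) M M')"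

definition is_slp2d :: "'s slp2d \<Rightarrow> bool" where
  "is_slp2d G \<longleftrightarrow>
     finite (lits G) \<and> finite (hors G) \<and> finite (vers G) \<and> finite (sigma G) \<and>
     lits G \<noteq> {} \<and>
     lits G \<inter> hors G = {} \<and> lits G \<inter> vers G = {} \<and> hors G \<inter> vers G = {} \<and>
     nonterms G \<inter> sigma G = {} \<and>
     start G \<in> nonterms G \<and>
     (\<forall>N \<in> lits G. \<exists>a \<in> sigma G. rhs G N = [a]) \<and>
     (\<forall>N \<in> hors G \<union> vers G. \<exists>A \<in> nonterms G. \<exists>B \<in> nonterms G. rhs G N = [A, B]) \<and>
     (\<exists>Ns. distinct Ns \<and> set Ns = nonterms G \<and>
        (\<forall>i < length Ns. Ns ! i \<in> hors G \<union> vers G \<longrightarrow>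
           set (rhs G (Ns ! i)) \<subseteq> {Ns ! j | j. i < j \<and> j < length Ns})) \<and>
     (\<forall>N \<in> hors G. \<forall>A B M M'. rhs G N = [A, B] \<and> expands G A M \<and> expands G B M'
        \<longrightarrow> ncols M = ncols M') \<and>
     (\<forall>N \<in> vers G. \<forall>A B M M'. rhs G N = [A, B] \<and> expands G A M \<and> expands G B M'
        \<longrightarrow> nrows M = nrows M')"

definition represents :: "'s slp2d \<Rightarrow> 's list list \<Rightarrow> bool" where
  "represents G T \<longleftrightarrow> expands G (start G) T"

definition slp_size :: "'s slp2d \<Rightarrow> nat" where
  "slp_size G = (\<Sum>N \<in> nonterms G. max (length (rhs G N)) 1)"

section \<open>Word RAM\<close>

text \<open>
  Machine words of \<open>w\<close> bits are the natural numbers below \<open>2 ^ w\<close>, and arithmetic is modulo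
  \<open>2 ^ w\<close>. A program is a finite list of instructions, hence names only finitely many registers;
  all further storage is in the memory, a finite array of words. An access outside the
  array has no successor configuration, so a halting run uses no memory beyond it.
\<close>

datatype binop = ADD | SUB | MUL | DIV | MOD | AND | OR | XOR | SHL | SHR

datatype cmp = EQ | LT | LE

datatype instr =
    Const nat nat            \<comment> \<open>target register, immediate value\<close>
  | Op binop nat nat nat     \<comment> \<open>target register, operand registers\<close>
  | Load nat nat             \<comment> \<open>target register, address register\<close>
  | Store nat nat            \<comment> \<open>address register, source register\<close>
  | Jump nat
  | JumpIf cmp nat nat nat   \<comment> \<open>registers compared, jump target\<close>
  | Halt

fun binop_val :: "nat \<Rightarrow> binop \<Rightarrow> nat \<Rightarrow> nat \<Rightarrow> nat" where
  "binop_val w ADD x y = (x + y) mod 2 ^ w"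
| "binop_val w SUB x y = nat ((int x - int y) mod 2 ^ w)"
| "binop_val w MUL x y = (x * y) mod 2 ^ w"
| "binop_val w DIV x y = x div y"
| "binop_val w MOD x y = x mod y"
| "binop_val w AND x y = Bit_Operations.and x y"
| "binop_val w OR x y = Bit_Operations.or x y"
| "binop_val w XOR x y = Bit_Operations.xor x y"
| "binop_val w SHL x y = push_bit y x mod 2 ^ w"
| "binop_val w SHR x y = drop_bit y x"

fun cmp_val :: "cmp \<Rightarrow> nat \<Rightarrow> nat \<Rightarrow> bool" where
  "cmp_val EQ x y \<longleftrightarrow> x = y"
| "cmp_val LT x y \<longleftrightarrow> x < y"
| "cmp_val LE x y \<longleftrightarrow> x \<le> y"

text \<open>Program counter, registers, memory.\<close>

type_synonym config = "nat \<times> (nat \<Rightarrow> nat) \<times> nat list"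

fun exec_instr :: "nat \<Rightarrow> instr \<Rightarrow> config \<Rightarrow> config option" where
  "exec_instr w (Const d k) (pc, R, D) = Some (pc + 1, R(d := k mod 2 ^ w), D)"
| "exec_instr w (Op b d x y) (pc, R, D) = Some (pc + 1, R(d := binop_val w b (R x) (R y)), D)"
| "exec_instr w (Load d a) (pc, R, D) =
     (if R a < length D then Some (pc + 1, R(d := D ! R a), D) else None)"
| "exec_instr w (Store a x) (pc, R, D) =
     (if R a < length D then Some (pc + 1, R, D[R a := R x]) else None)"
| "exec_instr w (Jump l) (pc, R, D) = Some (l, R, D)"
| "exec_instr w (JumpIf b x y l) (pc, R, D) =
     Some (if cmp_val b (R x) (R y) then l else pc + 1, R, D)"
| "exec_instr w Halt (pc, R, D) = None"

definition step :: "nat \<Rightarrow> instr list \<Rightarrow> config \<Rightarrow> config option" where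
  "step w P \<sigma> = (if fst \<sigma> < length P then exec_instr w (P ! fst \<sigma>) \<sigma> else None)"

fun steps :: "nat \<Rightarrow> instr list \<Rightarrow> nat \<Rightarrow> config \<Rightarrow> config option" where
  "steps w P 0 \<sigma> = Some \<sigma>"
| "steps w P (Suc t) \<sigma> = Option.bind (step w P \<sigma>) (steps w P t)"

text \<open>
  Started on the data structure \<open>D\<close> with the query \<open>(i, j)\<close> in registers 0 and 1, the program
  halts after \<open>t\<close> operations with the answer in register 0. The data structure must be intact
  afterwards, so that it can serve further queries.
\<close>

definition query_answer ::
    "nat \<Rightarrow> instr list \<Rightarrow> nat list \<Rightarrow> nat \<Rightarrow> nat \<Rightarrow> nat \<Rightarrow> nat \<Rightarrow> bool" where
  "query_answer w P D i j t v \<longleftrightarrow>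
     (\<exists>pc R. steps w P t (0, (\<lambda>_. 0)(0 := i, 1 := j), D) = Some (pc, R, D) \<and>
        pc < length P \<and> P ! pc = Halt \<and> R 0 = v)"

text \<open>
  The logarithm inside O-bounds; equal to the binary logarithm for \<open>n \<ge> 2\<close>, and 1 for \<open>n = 1\<close>,
  where the literal bounds would be 0.
\<close>

definition lg :: "nat \<Rightarrow> real" where
  "lg n = max 1 (log 2 (real n))"

end

theory Submission
  imports Defs
begin

text \<open>
  Close the nonterminals under mirroring the rows and the columns of their expansions. For an
  oriented expansion \<open>x\<close> and scales \<open>p\<close>, \<open>q\<close>, consider the block of the positions \<open>(i, j)\<close> of \<open>x\<close>
  with \<open>2 ^ p \<le> i < 2 ^ (p + 1)\<close> and \<open>2 ^ q \<le> j < 2 ^ (q + 1)\<close>. The deepest node of the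
  derivation of \<open>x\<close> that contains the whole block is either a literal, which is the answer, or it
  is cut by its rule inside the block. In the latter case the query moves to one of the two
  children, and measuring its position from the cut (the child before the cut is mirrored) makes
  the scale in the direction of the cut strictly smaller, while the other coordinate does not
  grow. One such jump per \<open>(x, p, q)\<close> is stored, which is constant space for each of the
  \<open>O(g log\<^sup>2 n)\<close> triples; since \<open>p + q\<close> decreases, \<open>O(log n)\<close> jumps suffice. The scales are not
  computed from the query but lowered one at a time, so that all tests cost \<open>O(log n)\<close> in total.
\<close>

section \<open>The query program\<close>

text \<open>
  The memory consists of records \<open>[tag, a, y, z, u]\<close>, and a state is the address of a record, kept in
  register 2. Tag 0 returns \<open>a\<close>. All other tags continue with state \<open>y\<close> if the tested coordinate is
  less than \<open>a\<close>, and with \<open>z\<close> otherwise: tags 1 and 2 only test \<open>i\<close> and \<open>j\<close>; tags 3 and 4 test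
  \<open>i\<close> and \<open>j\<close>, replace the tested coordinate by its distance from the cut before position \<open>a\<close>, and
  subtract \<open>u\<close> from the other one.
\<close>

definition lookup_prog :: "instr list" where
  "lookup_prog =
    [Const 3 1,
     Load 4 2, Op ADD 2 2 3, Load 5 2, Const 6 0, JumpIf EQ 4 6 32,
     Op ADD 2 2 3, Load 6 2, Op ADD 2 2 3, Load 7 2, Op ADD 2 2 3, Load 8 2,
     JumpIf EQ 4 3 24, Const 9 2, JumpIf EQ 4 9 26, Const 9 3, JumpIf EQ 4 9 34,
     Op SUB 0 0 8, JumpIf LT 1 5 22, Op SUB 1 1 5, Op ADD 1 1 3, Jump 30,
     Op SUB 1 5 1, Jump 28,
     JumpIf LT 0 5 28, Jump 30,
     JumpIf LT 1 5 28, Jump 30,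
     Op OR 2 6 6, Jump 1,
     Op OR 2 7 7, Jump 1,
     Op OR 0 5 5, Halt,
     Op SUB 1 1 8, JumpIf LT 0 5 39, Op SUB 0 0 5, Op ADD 0 0 3, Jump 30,
     Op SUB 0 5 0, Jump 28]"

text \<open>The loop of \<open>lookup_prog\<close> starts at program counter 1; register 3 holds the constant 1.
  At most \<open>n\<close> records are visited, at a cost of at most 25 operations each.\<close>

definition answers :: "nat \<Rightarrow> nat list \<Rightarrow> nat \<Rightarrow> nat \<Rightarrow> nat \<Rightarrow> nat \<Rightarrow> nat \<Rightarrow> bool" where
  "answers w D s i j n v \<longleftrightarrow>
     (\<forall>R. R 0 = i \<and> R 1 = j \<and> R 2 = s \<and> R 3 = 1 \<longrightarrow>
        (\<exists>t pc R'. t \<le> 25 * n \<and> steps w lookup_prog t (1, R, D) = Some (pc, R', D) \<and>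
           pc < length lookup_prog \<and> lookup_prog ! pc = Halt \<and> R' 0 = v))"

section \<open>Composition and symbolic execution of runs\<close>

lemma steps_add: "steps w P (a + b) \<sigma> = Option.bind (steps w P a \<sigma>) (steps w P b)"
  by (induction a arbitrary: \<sigma>) (auto split: bind_splits)

text \<open>A visit of a record ends where it began, at program counter 1, so visits concatenate and
  their budgets of 25 operations add up.\<close>

lemma answers_stepI:
  assumes "\<And>R. R 0 = i \<Longrightarrow> R 1 = j \<Longrightarrow> R 2 = s \<Longrightarrow> R 3 = 1 \<Longrightarrow>
      \<exists>t\<le>25. \<exists>R'. steps w lookup_prog t (1, R, D) = Some (1, R', D) \<and>
        R' 0 = i' \<and> R' 1 = j' \<and> R' 2 = s' \<and> R' 3 = 1"
    and "answers w D s' i' j' n v"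
  shows "answers w D s i j (Suc n) v"
  unfolding answers_def
proof (intro allI impI)
  fix R :: "nat \<Rightarrow> nat"
  assume "R 0 = i \<and> R 1 = j \<and> R 2 = s \<and> R 3 = 1"
  then obtain t R' where t: "t \<le> 25" "steps w lookup_prog t (1, R, D) = Some (1, R', D)"
    "R' 0 = i'" "R' 1 = j'" "R' 2 = s'" "R' 3 = 1"
    using assms(1) by blast
  obtain t' pc R'' where t': "t' \<le> 25 * n" "steps w lookup_prog t' (1, R', D) = Some (pc, R'', D)"
    "pc < length lookup_prog" "lookup_prog ! pc = Halt" "R'' 0 = v"
    using assms(2) t(3-6) unfolding answers_def by blast
  have "steps w lookup_prog (t + t') (1, R, D) = Some (pc, R'', D)"
    using t t' by (simp add: steps_add)
  then show "\<exists>t pc R'. t \<le> 25 * Suc n \<and> steps w lookup_prog t (1, R, D) = Some (pc, R', D) \<and>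
      pc < length lookup_prog \<and> lookup_prog ! pc = Halt \<and> R' 0 = v"
    using t t' by (intro exI[of _ "t + t'"] exI[of _ pc] exI[of _ R'']) auto
qed

text \<open>The runs considered never wrap around. The conditional rules \<open>SUB_val\<close> and
  \<open>ADD_val\<close> therefore replace the modular defining equations, which leave the simpset
  before any run is computed.\<close>

lemma SUB_val: "y \<le> x \<Longrightarrow> x < 2 ^ w \<Longrightarrow> binop_val w SUB x y = x - y"
  by (simp add: nat_mod_distrib flip: of_nat_diff)

lemma ADD_val: "x + y < 2 ^ w \<Longrightarrow> binop_val w ADD x y = x + y"
  by simp

lemma steps_numeral:
  "steps w P (numeral k) \<sigma> = Option.bind (step w P \<sigma>) (steps w P (pred_numeral k))"
  by (simp add: numeral_eq_Suc)

lemma steps_1: "steps w P 1 \<sigma> = step w P \<sigma>"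
  by (cases "step w P \<sigma>") auto

text \<open>41 is the length of the program. Keeping \<open>lookup_prog\<close> folded lets
  \<open>simp\<close> execute it one instruction at a time through
  \<open>lookup_prog_nth\<close>.\<close>

lemma step_lookup_prog:
  "pc < 41 \<Longrightarrow> step w lookup_prog (pc, R, D) = exec_instr w (lookup_prog ! pc) (pc, R, D)"
  by (simp add: step_def lookup_prog_def)

lemma lookup_prog_nth:
  "lookup_prog ! 0 = Const 3 1"
  "lookup_prog ! 1 = Load 4 2"
  "lookup_prog ! 2 = Op ADD 2 2 3"
  "lookup_prog ! 3 = Load 5 2"
  "lookup_prog ! 4 = Const 6 0"
  "lookup_prog ! 5 = JumpIf EQ 4 6 32"
  "lookup_prog ! 6 = Op ADD 2 2 3"
  "lookup_prog ! 7 = Load 6 2"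
  "lookup_prog ! 8 = Op ADD 2 2 3"
  "lookup_prog ! 9 = Load 7 2"
  "lookup_prog ! 10 = Op ADD 2 2 3"
  "lookup_prog ! 11 = Load 8 2"
  "lookup_prog ! 12 = JumpIf EQ 4 3 24"
  "lookup_prog ! 13 = Const 9 2"
  "lookup_prog ! 14 = JumpIf EQ 4 9 26"
  "lookup_prog ! 15 = Const 9 3"
  "lookup_prog ! 16 = JumpIf EQ 4 9 34"
  "lookup_prog ! 17 = Op SUB 0 0 8"
  "lookup_prog ! 18 = JumpIf LT 1 5 22"
  "lookup_prog ! 19 = Op SUB 1 1 5"
  "lookup_prog ! 20 = Op ADD 1 1 3"
  "lookup_prog ! 21 = Jump 30"
  "lookup_prog ! 22 = Op SUB 1 5 1"
  "lookup_prog ! 23 = Jump 28"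
  "lookup_prog ! 24 = JumpIf LT 0 5 28"
  "lookup_prog ! 25 = Jump 30"
  "lookup_prog ! 26 = JumpIf LT 1 5 28"
  "lookup_prog ! 27 = Jump 30"
  "lookup_prog ! 28 = Op OR 2 6 6"
  "lookup_prog ! 29 = Jump 1"
  "lookup_prog ! 30 = Op OR 2 7 7"
  "lookup_prog ! 31 = Jump 1"
  "lookup_prog ! 32 = Op OR 0 5 5"
  "lookup_prog ! 33 = Halt"
  "lookup_prog ! 34 = Op SUB 1 1 8"
  "lookup_prog ! 35 = JumpIf LT 0 5 39"
  "lookup_prog ! 36 = Op SUB 0 0 5"
  "lookup_prog ! 37 = Op ADD 0 0 3"
  "lookup_prog ! 38 = Jump 30"
  "lookup_prog ! 39 = Op SUB 0 5 0"
  "lookup_prog ! 40 = Jump 28"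
  by (simp_all add: lookup_prog_def)

lemmas run_simps = steps_1 steps_numeral step_lookup_prog lookup_prog_nth SUB_val ADD_val

declare binop_val.simps(1,2) [simp del]

section \<open>Effect of visiting one record, by tag\<close>

context
  fixes w :: nat and D :: "nat list" and s :: nat
  assumes s: "s + 4 < length D" and D: "length D \<le> 2 ^ w"
begin

text \<open>The five words of the record at \<open>s\<close> have addresses below
  \<open>2 ^ w\<close>, so \<open>2 ^ w\<close> exceeds 4. Hence the immediates of the program, all
  at most 3, survive the reduction modulo \<open>2 ^ w\<close>.\<close>

lemma w_ge_3: "3 \<le> w"
proof (rule ccontr)
  assume "\<not> 3 \<le> w"
  then have "(2::nat) ^ w \<le> 2 ^ 2" by (intro power_increasing) auto
  then show False using s D by simp
qed

lemma eight_le: "8 \<le> (2::nat) ^ w"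
  using power_increasing[OF w_ge_3, of "2::nat"] by simp

lemmas small = eight_le s D

lemma answers_leaf:
  assumes "D ! s = 0" shows "answers w D s i j 1 (D ! (s + 1))"
  unfolding answers_def
proof (intro allI impI)
  fix R :: "nat \<Rightarrow> nat"
  assume R: "R 0 = i \<and> R 1 = j \<and> R 2 = s \<and> R 3 = 1"
  \<comment> \<open>Tag 0 is tested right after \<open>a\<close> is loaded: five operations reach
    the jump to 32, and the sixth copies \<open>a\<close>.\<close>
  have "steps w lookup_prog 6 (1, R, D) =
    Some (33, R(4 := 0, 2 := s + 1, 5 := D ! (s + 1), 6 := 0, 0 := D ! (s + 1)), D)"
    using R small assms
    by (simp add: run_simps del: One_nat_def add_2_eq_Suc add_2_eq_Suc')
  then show "\<exists>t pc R'. t \<le> 25 * 1 \<and> steps w lookup_prog t (1, R, D) = Some (pc, R', D) \<and>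
      pc < length lookup_prog \<and> lookup_prog ! pc = Halt \<and> R' 0 = D ! (s + 1)"
    by (intro exI[of _ 6] exI conjI) (assumption | simp add: lookup_prog_def)+
qed

text \<open>The part of a visit common to all nonzero tags. Nothing is claimed about register 2: it
  has moved along the record and is set anew before the next visit.\<close>

lemma fetch_record:
  assumes "R 2 = s" "R 3 = 1" "D ! s \<noteq> 0"
  shows "\<exists>R'. steps w lookup_prog 11 (1, R, D) = Some (12, R', D) \<and>
    R' 0 = R 0 \<and> R' 1 = R 1 \<and> R' 3 = 1 \<and> R' 4 = D ! s \<and> R' 5 = D ! (s + 1) \<and>
    R' 6 = D ! (s + 2) \<and> R' 7 = D ! (s + 3) \<and> R' 8 = D ! (s + 4)"
  using assms small
  by (simp add: run_simps add.assoc del: One_nat_def add_2_eq_Suc add_2_eq_Suc')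

text \<open>The 11 operations of \<open>fetch_record\<close> leave 14 of the 25 for the branch
  selected by the tag.\<close>

lemma answers_recordI:
  assumes "\<And>R. R 0 = i \<Longrightarrow> R 1 = j \<Longrightarrow> R 3 = 1 \<Longrightarrow> R 4 = D ! s \<Longrightarrow> R 5 = D ! (s + 1) \<Longrightarrow>
      R 6 = D ! (s + 2) \<Longrightarrow> R 7 = D ! (s + 3) \<Longrightarrow> R 8 = D ! (s + 4) \<Longrightarrow>
      \<exists>t\<le>14. \<exists>R'. steps w lookup_prog t (12, R, D) = Some (1, R', D) \<and>
        R' 0 = i' \<and> R' 1 = j' \<and> R' 2 = s' \<and> R' 3 = 1"
    and "D ! s \<noteq> 0" and "answers w D s' i' j' n v"
  shows "answers w D s i j (Suc n) v"
proof (rule answers_stepI[OF _ assms(3)])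
  fix R :: "nat \<Rightarrow> nat"
  assume R: "R 0 = i" "R 1 = j" "R 2 = s" "R 3 = 1"
  obtain R' where R': "steps w lookup_prog 11 (1, R, D) = Some (12, R', D)"
    "R' 0 = i" "R' 1 = j" "R' 3 = 1" "R' 4 = D ! s" "R' 5 = D ! (s + 1)"
    "R' 6 = D ! (s + 2)" "R' 7 = D ! (s + 3)" "R' 8 = D ! (s + 4)"
    using fetch_record[of R] assms(2) R by blast
  obtain t R'' where "t \<le> 14" "steps w lookup_prog t (12, R', D) = Some (1, R'', D)"
    "R'' 0 = i'" "R'' 1 = j'" "R'' 2 = s'" "R'' 3 = 1"
    using assms(1)[of R'] R' by blast
  then show "\<exists>t\<le>25. \<exists>R'. steps w lookup_prog t (1, R, D) = Some (1, R', D) \<and>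
        R' 0 = i' \<and> R' 1 = j' \<and> R' 2 = s' \<and> R' 3 = 1"
    using R'(1) by (intro exI[of _ "11 + t"]) (simp only: steps_add, simp)
qed

lemma answers_test_row:
  assumes tag: "D ! s = 1"
    and "answers w D (D ! (s + (if i < D ! (s + 1) then 2 else 3))) i j n v"
  shows "answers w D s i j (Suc n) v"
proof (rule answers_recordI[OF _ _ assms(2)])
  fix R :: "nat \<Rightarrow> nat"
  assume R: "R 0 = i" "R 1 = j" "R 3 = 1" "R 4 = D ! s" "R 5 = D ! (s + 1)" "R 6 = D ! (s + 2)"
    "R 7 = D ! (s + 3)" "R 8 = D ! (s + 4)"
  show "\<exists>t\<le>14. \<exists>R'. steps w lookup_prog t (12, R, D) = Some (1, R', D) \<and>
    R' 0 = i \<and> R' 1 = j \<and>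
    R' 2 = D ! (s + (if i < D ! (s + 1) then 2 else 3)) \<and> R' 3 = 1"
    using R tag eight_le
    \<comment> \<open>The exact run lengths; the branch to \<open>z\<close> needs one more jump than
      the branch to \<open>y\<close>.\<close>
    by (intro exI[of _ "if i < D ! (s + 1) then 4 else 5"])
      (simp add: run_simps del: One_nat_def add_2_eq_Suc add_2_eq_Suc')
qed (use tag in simp)

lemma answers_test_col:
  assumes tag: "D ! s = 2"
    and "answers w D (D ! (s + (if j < D ! (s + 1) then 2 else 3))) i j n v"
  shows "answers w D s i j (Suc n) v"
proof (rule answers_recordI[OF _ _ assms(2)])
  fix R :: "nat \<Rightarrow> nat"
  assume R: "R 0 = i" "R 1 = j" "R 3 = 1" "R 4 = D ! s" "R 5 = D ! (s + 1)" "R 6 = D ! (s + 2)"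
    "R 7 = D ! (s + 3)" "R 8 = D ! (s + 4)"
  show "\<exists>t\<le>14. \<exists>R'. steps w lookup_prog t (12, R, D) = Some (1, R', D) \<and>
    R' 0 = i \<and> R' 1 = j \<and>
    R' 2 = D ! (s + (if j < D ! (s + 1) then 2 else 3)) \<and> R' 3 = 1"
    using R tag eight_le
    by (intro exI[of _ "if j < D ! (s + 1) then 6 else 7"])
      (simp add: run_simps del: One_nat_def add_2_eq_Suc add_2_eq_Suc')
qed (use tag in simp)

text \<open>The premises exclude wrap-around: a positive cut field keeps
  \<open>i - D ! (s + 1) + 1\<close> at most \<open>i\<close>, and
  \<open>D ! (s + 4) \<le> j\<close> makes the other subtraction exact.\<close>

lemma answers_row:
  assumes tag: "D ! s = 3" and "i < 2 ^ w" "j < 2 ^ w" "D ! (s + 1) < 2 ^ w"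
      "0 < D ! (s + 1)" "D ! (s + 4) \<le> j"
    and "answers w D (D ! (s + (if i < D ! (s + 1) then 2 else 3)))
      (if i < D ! (s + 1) then D ! (s + 1) - i else i - D ! (s + 1) + 1) (j - D ! (s + 4)) n v"
  shows "answers w D s i j (Suc n) v"
proof (rule answers_recordI[OF _ _ assms(7)])
  fix R :: "nat \<Rightarrow> nat"
  assume R: "R 0 = i" "R 1 = j" "R 3 = 1" "R 4 = D ! s" "R 5 = D ! (s + 1)" "R 6 = D ! (s + 2)"
    "R 7 = D ! (s + 3)" "R 8 = D ! (s + 4)"
  show "\<exists>t\<le>14. \<exists>R'. steps w lookup_prog t (12, R, D) = Some (1, R', D) \<and>
    R' 0 = (if i < D ! (s + 1) then D ! (s + 1) - i else i - D ! (s + 1) + 1) \<and>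
    R' 1 = (j - D ! (s + 4)) \<and>
    R' 2 = D ! (s + (if i < D ! (s + 1) then 2 else 3)) \<and> R' 3 = 1"
    using R assms(1-6) eight_le
    by (intro exI[of _ "if i < D ! (s + 1) then 11 else 12"])
      (simp add: run_simps del: One_nat_def add_2_eq_Suc add_2_eq_Suc')
qed (use tag in simp)

text \<open>Tag 4 is the case that falls through all tag tests of the program.\<close>

lemma answers_col:
  assumes tag: "D ! s = 4" and "i < 2 ^ w" "j < 2 ^ w" "D ! (s + 1) < 2 ^ w"
      "0 < D ! (s + 1)" "D ! (s + 4) \<le> i"
    and "answers w D (D ! (s + (if j < D ! (s + 1) then 2 else 3)))
      (i - D ! (s + 4)) (if j < D ! (s + 1) then D ! (s + 1) - j else j - D ! (s + 1) + 1) n v"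
  shows "answers w D s i j (Suc n) v"
proof (rule answers_recordI[OF _ _ assms(7)])
  fix R :: "nat \<Rightarrow> nat"
  assume R: "R 0 = i" "R 1 = j" "R 3 = 1" "R 4 = D ! s" "R 5 = D ! (s + 1)" "R 6 = D ! (s + 2)"
    "R 7 = D ! (s + 3)" "R 8 = D ! (s + 4)"
  show "\<exists>t\<le>14. \<exists>R'. steps w lookup_prog t (12, R, D) = Some (1, R', D) \<and>
    R' 0 = (i - D ! (s + 4)) \<and>
    R' 1 = (if j < D ! (s + 1) then D ! (s + 1) - j else j - D ! (s + 1) + 1) \<and>
    R' 2 = D ! (s + (if j < D ! (s + 1) then 2 else 3)) \<and> R' 3 = 1"
    using R assms(1-6) eight_le
    by (intro exI[of _ "if j < D ! (s + 1) then 11 else 12"])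
      (simp add: run_simps del: One_nat_def add_2_eq_Suc add_2_eq_Suc')
qed (use tag in simp)

end

section \<open>Blocks and cuts\<close>

text \<open>Positions are counted from 1, as in \<open>access2d\<close>.\<close>

locale grid =
  fixes X :: "'x set" and R C :: "'x \<Rightarrow> nat" and acc :: "'x \<Rightarrow> nat \<Rightarrow> nat \<Rightarrow> nat"
  assumes finite_X: "finite X"
    and pos: "x \<in> X \<Longrightarrow> 0 < R x \<and> 0 < C x"
    and split: "x \<in> X \<Longrightarrow> (R x = 1 \<and> C x = 1) \<or>
      (\<exists>y\<in>X. \<exists>z\<in>X. R x = R y + R z \<and> C y = C x \<and> C z = C x \<and>
         (\<forall>i\<in>{1..R x}. \<forall>j\<in>{1..C x}.
            acc x i j = (if i \<le> R y then acc y i j else acc z (i - R y) j))) \<or>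
      (\<exists>y\<in>X. \<exists>z\<in>X. C x = C y + C z \<and> R y = R x \<and> R z = R x \<and>
         (\<forall>i\<in>{1..R x}. \<forall>j\<in>{1..C x}.
            acc x i j = (if j \<le> C y then acc y i j else acc z i (j - C y))))"
    and flip_rows: "x \<in> X \<Longrightarrow> \<exists>y\<in>X. R y = R x \<and> C y = C x \<and>
      (\<forall>i\<in>{1..R x}. \<forall>j\<in>{1..C x}. acc y i j = acc x (R x + 1 - i) j)"
    and flip_cols: "x \<in> X \<Longrightarrow> \<exists>y\<in>X. R y = R x \<and> C y = C x \<and>
      (\<forall>i\<in>{1..R x}. \<forall>j\<in>{1..C x}. acc y i j = acc x i (C x + 1 - j))"
begin

text \<open>\<open>t\<close> is the last row before the cut, and \<open>u\<close> counts the columns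
  of \<open>x\<close> in front of the node being cut. \<open>y\<close> is the mirrored upper part,
  so both distances count from 1 at the cut; the dimension bounds keep the next query in
  range.\<close>

definition cut_rows :: "'x \<Rightarrow> nat set \<Rightarrow> nat set \<Rightarrow> nat \<Rightarrow> nat \<Rightarrow> 'x \<Rightarrow> 'x \<Rightarrow> bool" where
  "cut_rows x I J t u y z \<longleftrightarrow> y \<in> X \<and> z \<in> X \<and> (\<forall>j\<in>J. u < j) \<and> (\<forall>i\<in>I. \<forall>j\<in>J.
     (i \<le> t \<longrightarrow> t + 1 - i \<le> R y \<and> j - u \<le> C y \<and> acc x i j = acc y (t + 1 - i) (j - u)) \<and>
     (t < i \<longrightarrow> i - t \<le> R z \<and> j - u \<le> C z \<and> acc x i j = acc z (i - t) (j - u)))"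

definition cut_cols :: "'x \<Rightarrow> nat set \<Rightarrow> nat set \<Rightarrow> nat \<Rightarrow> nat \<Rightarrow> 'x \<Rightarrow> 'x \<Rightarrow> bool" where
  "cut_cols x I J t u y z \<longleftrightarrow> y \<in> X \<and> z \<in> X \<and> (\<forall>i\<in>I. u < i) \<and> (\<forall>i\<in>I. \<forall>j\<in>J.
     (j \<le> t \<longrightarrow> t + 1 - j \<le> C y \<and> i - u \<le> R y \<and> acc x i j = acc y (i - u) (t + 1 - j)) \<and>
     (t < j \<longrightarrow> j - t \<le> C z \<and> i - u \<le> R z \<and> acc x i j = acc z (i - u) (j - t)))"

text \<open>The bounds on \<open>t\<close> put positions of the block on both sides of the cut; this
  is what later makes the scale drop.\<close>

definition cut where
  "cut x a a' b b' \<longleftrightarrow> (\<exists>v. \<forall>i\<in>{a..a'}. \<forall>j\<in>{b..b'}. acc x i j = v) \<or>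
     (\<exists>t u y z. a \<le> t \<and> t < a' \<and> cut_rows x {a..a'} {b..b'} t u y z) \<or>
     (\<exists>t u y z. b \<le> t \<and> t < b' \<and> cut_cols x {a..a'} {b..b'} t u y z)"

text \<open>If the block of \<open>x\<close> is a translate of one of \<open>y\<close>, a cut of
  \<open>y\<close> translates back: the cut position and the offset \<open>u\<close> grow by the
  shifts in their respective directions.\<close>

lemma cut_shift:
  assumes "cut y (a - h) (a' - h) (b - k) (b' - k)" "h < a" "k < b" "a \<le> a'" "b \<le> b'"
    and eq: "\<And>i j. i \<in> {a..a'} \<Longrightarrow> j \<in> {b..b'} \<Longrightarrow> acc x i j = acc y (i - h) (j - k)"
  shows "cut x a a' b b'"
  using assms(1)[unfolded cut_def]
proof (elim disjE exE conjE)
  fix v assume "\<forall>i\<in>{a - h..a' - h}. \<forall>j\<in>{b - k..b' - k}. acc y i j = v"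
  moreover have "i - h \<in> {a - h..a' - h} \<and> j - k \<in> {b - k..b' - k}"
    if "i \<in> {a..a'}" "j \<in> {b..b'}" for i j using that by auto
  ultimately have "\<forall>i\<in>{a..a'}. \<forall>j\<in>{b..b'}. acc x i j = v" using eq by simp
  then show ?thesis unfolding cut_def by blast
next
  fix t u y' z
  assume t: "a - h \<le> t" "t < a' - h" and c: "cut_rows y {a - h..a' - h} {b - k..b' - k} t u y' z"
  have "cut_rows x {a..a'} {b..b'} (t + h) (u + k) y' z"
    unfolding cut_rows_def
  proof (intro conjI ballI impI)
    show "y' \<in> X" "z \<in> X" using c by (auto simp: cut_rows_def)
  next
    fix j assume "j \<in> {b..b'}"
    then have "j - k \<in> {b - k..b' - k}" by auto
    then have "u < j - k" using c by (auto simp: cut_rows_def)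
    then show "u + k < j" by auto
  next
    fix i j assume i: "i \<in> {a..a'}" and j: "j \<in> {b..b'}"
    then have ij: "i - h \<in> {a - h..a' - h}" "j - k \<in> {b - k..b' - k}" by auto
    have ge: "h < i" "k < j" using i j assms by auto
    have r: "j - (u + k) = j - k - u" by simp
    {
      assume "i \<le> t + h"
      \<comment> \<open>With truncated subtraction this equation relies on
        \<open>h < i\<close>.\<close>
      then have l: "i - h \<le> t" and e: "t + 1 - (i - h) = t + h + 1 - i" using ge by auto
      then show "t + h + 1 - i \<le> R y'" "j - (u + k) \<le> C y'"
        "acc x i j = acc y' (t + h + 1 - i) (j - (u + k))"
        using c ij eq[OF i j] unfolding cut_rows_def r by metis+
    next
      assume "t + h < i"
      then have l: "t < i - h" and e: "i - h - t = i - (t + h)" by auto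
      then show "i - (t + h) \<le> R z" "j - (u + k) \<le> C z"
        "acc x i j = acc z (i - (t + h)) (j - (u + k))"
        using c ij eq[OF i j] unfolding cut_rows_def r by metis+
    }
  qed
  moreover have "a \<le> t + h" "t + h < a'" using t by auto
  ultimately show ?thesis unfolding cut_def by blast
next
  fix t u y' z
  assume t: "b - k \<le> t" "t < b' - k" and c: "cut_cols y {a - h..a' - h} {b - k..b' - k} t u y' z"
  have "cut_cols x {a..a'} {b..b'} (t + k) (u + h) y' z"
    unfolding cut_cols_def
  proof (intro conjI ballI impI)
    show "y' \<in> X" "z \<in> X" using c by (auto simp: cut_cols_def)
  next
    fix i assume "i \<in> {a..a'}"
    then have "i - h \<in> {a - h..a' - h}" by auto
    then have "u < i - h" using c by (auto simp: cut_cols_def)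
    then show "u + h < i" by auto
  next
    fix i j assume i: "i \<in> {a..a'}" and j: "j \<in> {b..b'}"
    then have ij: "i - h \<in> {a - h..a' - h}" "j - k \<in> {b - k..b' - k}" by auto
    have ge: "h < i" "k < j" using i j assms by auto
    have r: "i - (u + h) = i - h - u" by simp
    {
      assume "j \<le> t + k"
      then have l: "j - k \<le> t" and e: "t + 1 - (j - k) = t + k + 1 - j" using ge by auto
      then show "t + k + 1 - j \<le> C y'" "i - (u + h) \<le> R y'"
        "acc x i j = acc y' (i - (u + h)) (t + k + 1 - j)"
        using c ij eq[OF i j] unfolding cut_cols_def r by metis+
    next
      assume "t + k < j"
      then have l: "t < j - k" and e: "j - k - t = j - (t + k)" by auto
      then show "j - (t + k) \<le> C z" "i - (u + h) \<le> R z"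
        "acc x i j = acc z (i - (u + h)) (j - (t + k))"
        using c ij eq[OF i j] unfolding cut_cols_def r by metis+
    }
  qed
  moreover have "b \<le> t + k" "t + k < b'" using t by auto
  ultimately show ?thesis unfolding cut_def by blast
qed

text \<open>Induction on \<open>R x + C x\<close> follows the derivation: while the block lies in
  one part of the split, \<open>cut_shift\<close> carries the cut of that part back to
  \<open>x\<close>. The first split through the block is itself the cut, with offset 0.\<close>

lemma cut_exists:
  assumes "x \<in> X" "0 < a" "a \<le> a'" "a' \<le> R x" "0 < b" "b \<le> b'" "b' \<le> C x"
  shows "cut x a a' b b'"
  using assms
proof (induction "R x + C x" arbitrary: x a a' b b' rule: less_induct)
  case less
  note prems = less.prems
  consider (leaf) "R x = 1" "C x = 1"
    | (rows) y z where "y \<in> X" "z \<in> X" "R x = R y + R z" "C y = C x" "C z = C x"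
      "\<And>i j. i \<in> {1..R x} \<Longrightarrow> j \<in> {1..C x} \<Longrightarrow>
         acc x i j = (if i \<le> R y then acc y i j else acc z (i - R y) j)"
    | (cols) y z where "y \<in> X" "z \<in> X" "C x = C y + C z" "R y = R x" "R z = R x"
      "\<And>i j. i \<in> {1..R x} \<Longrightarrow> j \<in> {1..C x} \<Longrightarrow>
         acc x i j = (if j \<le> C y then acc y i j else acc z i (j - C y))"
    using split[OF prems(1)] by blast
  then show ?case
  proof cases
    case leaf
    then have "\<forall>i\<in>{a..a'}. \<forall>j\<in>{b..b'}. i = 1 \<and> j = 1" using prems by auto
    then have "\<forall>i\<in>{a..a'}. \<forall>j\<in>{b..b'}. acc x i j = acc x 1 1" by metis
    then show ?thesis unfolding cut_def by blast
  next
    case rows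
    consider "a' \<le> R y" | "R y < a" | "a \<le> R y" "R y < a'" by linarith
    then show ?thesis
    proof cases
      case 1
      have "cut y a a' b b'" using less.hyps[of y] rows pos[of z] prems 1 by auto
      then show ?thesis using prems 1 by (intro cut_shift[of y a 0 a' b 0]) (auto simp: rows(6))
    next
      case 2
      have "cut z (a - R y) (a' - R y) b b'"
        using less.hyps[of z] rows pos[of y] prems 2 by auto
      then show ?thesis using prems 2 by (intro cut_shift[of z a "R y" a' b 0]) (auto simp: rows(6))
    next
      case 3
      obtain y' where y': "y' \<in> X" "R y' = R y" "C y' = C y"
        "\<And>i j. i \<in> {1..R y} \<Longrightarrow> j \<in> {1..C y} \<Longrightarrow> acc y' i j = acc y (R y + 1 - i) j"
        using flip_rows[OF rows(1)] by blast
      \<comment> \<open>Mirroring is an involution on the rows of \<open>y\<close>.\<close>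
      have "acc y' (R y + 1 - i) j = acc y i j" if "i \<in> {1..R y}" "j \<in> {1..C y}" for i j
        using that by (subst y'(4)) auto
      then have "cut_rows x {a..a'} {b..b'} (R y) 0 y' z"
        unfolding cut_rows_def using prems rows y'(1-3) by auto
      then show ?thesis using 3 unfolding cut_def by blast
    qed
  next
    case cols
    consider "b' \<le> C y" | "C y < b" | "b \<le> C y" "C y < b'" by linarith
    then show ?thesis
    proof cases
      case 1
      have "cut y a a' b b'" using less.hyps[of y] cols pos[of z] prems 1 by auto
      then show ?thesis using prems 1 by (intro cut_shift[of y a 0 a' b 0]) (auto simp: cols(6))
    next
      case 2
      have "cut z a a' (b - C y) (b' - C y)"
        using less.hyps[of z] cols pos[of y] prems 2 by auto
      then show ?thesis using prems 2 by (intro cut_shift[of z a 0 a' b "C y"]) (auto simp: cols(6))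
    next
      case 3
      obtain y' where y': "y' \<in> X" "R y' = R y" "C y' = C y"
        "\<And>i j. i \<in> {1..R y} \<Longrightarrow> j \<in> {1..C y} \<Longrightarrow> acc y' i j = acc y i (C y + 1 - j)"
        using flip_cols[OF cols(1)] by blast
      have "acc y' i (C y + 1 - j) = acc y i j" if "i \<in> {1..R y}" "j \<in> {1..C y}" for i j
        using that by (subst y'(4)) auto
      then have "cut_cols x {a..a'} {b..b'} (C y) 0 y' z"
        unfolding cut_cols_def using prems cols y'(1-3) by auto
      then show ?thesis using 3 unfolding cut_def by blast
    qed
  qed
qed

end

section \<open>The table of records\<close>

lemma answers_mono: "answers w D s i j n v \<Longrightarrow> n \<le> n' \<Longrightarrow> answers w D s i j n' v"
proof -
  assume "answers w D s i j n v" "n \<le> n'"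
  moreover have "t \<le> 25 * n'" if "t \<le> 25 * n" for t using that \<open>n \<le> n'\<close> by linarith
  ultimately show ?thesis unfolding answers_def by fast
qed

text \<open>The addresses \<open>e\<close> are fixed before the contents \<open>f\<close>, because
  records contain addresses of other records. \<open>q0\<close> gets address 0, the initial value of
  register 2.\<close>

lemma record_layout:
  assumes "finite Q" "q0 \<in> Q"
  obtains e :: "'q \<Rightarrow> nat" where "e q0 = 0" "\<forall>q\<in>Q. e q + 4 < 5 * card Q"
    "\<forall>f. (\<forall>q\<in>Q. length (f q) = 5) \<longrightarrow>
       (\<exists>D. length D = 5 * card Q \<and> (\<forall>q\<in>Q. \<forall>m<5. D ! (e q + m) = f q ! m) \<and>
           set D \<subseteq> (\<Union>q\<in>Q. set (f q) :: nat set))"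
proof -
  obtain qs' where qs': "set qs' = Q - {q0}" "distinct qs'"
    using finite_distinct_list[of "Q - {q0}"] assms by auto
  define qs where "qs = q0 # qs'"
  have qs: "set qs = Q" "distinct qs" "qs ! 0 = q0" "length qs = card Q"
    using qs' assms distinct_card[of qs] by (auto simp: qs_def card_insert_if)
  have "\<forall>q\<in>Q. \<exists>k<card Q. qs ! k = q" using qs by (metis in_set_conv_nth)
  then obtain k where k: "\<And>q. q \<in> Q \<Longrightarrow> k q < card Q" "\<And>q. q \<in> Q \<Longrightarrow> qs ! k q = q"
    by metis
  have "card Q > 0" using assms card_gt_0_iff by blast
  then have "k q0 = 0"
    using qs k[OF assms(2)] nth_eq_iff_index_eq[of qs "k q0" 0] by auto
  show thesis
  proof (rule that[of "\<lambda>q. 5 * k q"])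
    show "5 * k q0 = 0" using \<open>k q0 = 0\<close> by simp
    show "\<forall>q\<in>Q. 5 * k q + 4 < 5 * card Q" using k(1) by fastforce
  next
    show "\<forall>f. (\<forall>q\<in>Q. length (f q) = 5) \<longrightarrow>
       (\<exists>D. length D = 5 * card Q \<and> (\<forall>q\<in>Q. \<forall>m<5. D ! (5 * k q + m) = f q ! m) \<and>
           set D \<subseteq> (\<Union>q\<in>Q. set (f q) :: nat set))"
    proof (intro allI impI)
      fix f :: "'q \<Rightarrow> nat list"
      assume f: "\<forall>q\<in>Q. length (f q) = 5"
      define D where "D = map (\<lambda>a. f (qs ! (a div 5)) ! (a mod 5)) [0..<5 * card Q]"
      have "D ! (5 * k q + m) = f q ! m" if "q \<in> Q" "m < 5" for q m
        using k[OF that(1)] that(2) by (simp add: D_def)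
      moreover have "set D \<subseteq> (\<Union>q\<in>Q. set (f q))"
      proof
        fix v assume "v \<in> set D"
        then obtain a where a: "a < 5 * card Q" "v = f (qs ! (a div 5)) ! (a mod 5)"
          by (auto simp: D_def)
        then have "qs ! (a div 5) \<in> Q" using qs by (metis nth_mem less_mult_imp_div_less mult.commute)
        then show "v \<in> (\<Union>q\<in>Q. set (f q))" using a(2) f by force
      qed
      ultimately show "\<exists>D. length D = 5 * card Q \<and> (\<forall>q\<in>Q. \<forall>m<5. D ! (5 * k q + m) = f q ! m) \<and>
             set D \<subseteq> (\<Union>q\<in>Q. set (f q))"
        by (intro exI[of _ D]) (simp add: D_def)
    qed
  qed
qed

section \<open>Records for blocks, and the descent through them\<close>

context grid
begin

definition block :: "'x \<Rightarrow> nat \<Rightarrow> nat \<Rightarrow> nat \<Rightarrow> nat \<Rightarrow> bool" where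
  "block x p q i j \<longleftrightarrow> 2 ^ p \<le> i \<and> i < 2 ^ (p + 1) \<and> i \<le> R x \<and> 2 ^ q \<le> j \<and> j < 2 ^ (q + 1) \<and> j \<le> C x"

definition leaf_record :: "nat list \<Rightarrow> 'x \<Rightarrow> nat \<Rightarrow> nat \<Rightarrow> bool" where
  "leaf_record d x p q \<longleftrightarrow> d ! 0 = 0 \<and> (\<forall>i j. block x p q i j \<longrightarrow> d ! 1 = acc x i j)"

text \<open>\<open>y\<close> depends on the side of the cut. The bound \<open>i' < 2 ^ p\<close> is
  the one that scale \<open>p - 1\<close> demands, and \<open>0 < p\<close> excludes the truncated
  predecessor of 0.\<close>

definition row_record :: "('x \<times> nat \<times> nat \<times> nat \<Rightarrow> nat) \<Rightarrow> nat list \<Rightarrow> 'x \<Rightarrow> nat \<Rightarrow> nat \<Rightarrow> bool" where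
  "row_record e d x p q \<longleftrightarrow> d ! 0 = 3 \<and> 0 < d ! 1 \<and> 0 < p \<and> (\<forall>i j. block x p q i j \<longrightarrow>
     (\<exists>y\<in>X. \<exists>i' j'. d ! (if i < d ! 1 then 2 else 3) = e (y, p - 1, q, 0) \<and> d ! 4 \<le> j \<and>
        i' = (if i < d ! 1 then d ! 1 - i else i - d ! 1 + 1) \<and> j' = j - d ! 4 \<and>
        i' \<in> {1..R y} \<and> i' < 2 ^ p \<and> j' \<in> {1..C y} \<and> acc x i j = acc y i' j'))"

definition col_record :: "('x \<times> nat \<times> nat \<times> nat \<Rightarrow> nat) \<Rightarrow> nat list \<Rightarrow> 'x \<Rightarrow> nat \<Rightarrow> nat \<Rightarrow> bool" where
  "col_record e d x p q \<longleftrightarrow> d ! 0 = 4 \<and> 0 < d ! 1 \<and> 0 < q \<and> (\<forall>i j. block x p q i j \<longrightarrow>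
     (\<exists>y\<in>X. \<exists>i' j'. d ! (if j < d ! 1 then 2 else 3) = e (y, p, q - 1, 0) \<and> d ! 4 \<le> i \<and>
        j' = (if j < d ! 1 then d ! 1 - j else j - d ! 1 + 1) \<and> i' = i - d ! 4 \<and>
        i' \<in> {1..R y} \<and> j' < 2 ^ q \<and> j' \<in> {1..C y} \<and> acc x i j = acc y i' j'))"

text \<open>\<open>cut_exists\<close> is applied to the block. A cut after row \<open>t\<close>
  satisfies \<open>2 ^ p \<le> t\<close> and \<open>t < 2 ^ (p + 1)\<close>, so every row of the
  block is at distance less than \<open>2 ^ p\<close> from it; likewise for columns.\<close>

lemma block_record_exists:
  assumes x: "x \<in> X" and pq: "p \<le> L" "q \<le> L" and w: "L < w" "3 \<le> w"
    and e: "\<And>y p q. y \<in> X \<Longrightarrow> p \<le> L \<Longrightarrow> q \<le> L \<Longrightarrow> e (y, p, q, 0) < 2 ^ w"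
    and acc: "\<And>i j. i \<in> {1..R x} \<Longrightarrow> j \<in> {1..C x} \<Longrightarrow> acc x i j < 2 ^ w"
  shows "\<exists>d. length d = 5 \<and> set d \<subseteq> {..<2 ^ w} \<and>
    (leaf_record d x p q \<or> row_record e d x p q \<or> col_record e d x p q)"
proof (cases "2 ^ p \<le> R x \<and> 2 ^ q \<le> C x")
  case False
  \<comment> \<open>The block is empty, so the condition on the answer is vacuous.\<close>
  then have "leaf_record [0, 0, 0, 0, 0] x p q"
    unfolding leaf_record_def block_def by auto
  then show ?thesis by (intro exI[of _ "[0, 0, 0, 0, 0]"]) auto
next
  case True
  \<comment> \<open>The last row and column of the block, clipped to the dimensions of
    \<open>x\<close>.\<close>
  define a where "a = min (2 ^ (p + 1) - 1) (R x)"
  define b where "b = min (2 ^ (q + 1) - 1) (C x)"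
  have pow: "(0::nat) < 2 ^ p" "(0::nat) < 2 ^ q" by auto
  have ge: "2 ^ p \<le> a" "2 ^ q \<le> b" "a \<le> R x" "b \<le> C x" "a < 2 ^ (p + 1)" "b < 2 ^ (q + 1)"
    using True pow by (auto simp: a_def b_def min_less_iff_disj)
  have le_w: "(2::nat) ^ (p + 1) \<le> 2 ^ w" "(2::nat) ^ (q + 1) \<le> 2 ^ w" "(2::nat) ^ 3 \<le> 2 ^ w"
    using pq w by - (rule power_increasing; simp)+
  have block: "block x p q i j \<longleftrightarrow> i \<in> {2 ^ p..a} \<and> j \<in> {2 ^ q..b}" for i j
  proof -
    have "k \<le> m - 1 \<longleftrightarrow> k < m" if "0 < m" for k m :: nat using that by linarith
    then show ?thesis by (auto simp: block_def a_def b_def)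
  qed
  have "cut x (2 ^ p) a (2 ^ q) b" using x ge by (intro cut_exists) auto
  then show ?thesis unfolding cut_def
  proof (elim disjE exE conjE)
    fix v assume v: "\<forall>i\<in>{2 ^ p..a}. \<forall>j\<in>{2 ^ q..b}. acc x i j = v"
    then have "acc x a b = v" using ge by auto
    then have "v < 2 ^ w" using acc[of a b] ge pow by force
    moreover have "leaf_record [0, v, 0, 0, 0] x p q"
      using v by (auto simp: leaf_record_def block)
    ultimately show ?thesis by (intro exI[of _ "[0, v, 0, 0, 0]"]) auto
  next
    fix t u y z assume t: "2 ^ p \<le> t" "t < a" and c: "cut_rows x {2 ^ p..a} {2 ^ q..b} t u y z"
    \<comment> \<open>At scale 0 the block has a single row, which no cut can separate.\<close>
    have p: "0 < p" using t ge by (cases p) auto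
    have u: "u < 2 ^ q" using c ge by (auto simp: cut_rows_def)
    have X: "y \<in> X" "z \<in> X" using c by (auto simp: cut_rows_def)
    \<comment> \<open>The stored position is \<open>t + 1\<close> because the program tests
      strictly: \<open>i \<le> t\<close> becomes \<open>i < t + 1\<close>.\<close>
    let ?d = "[3, t + 1, e (y, p - 1, q, 0), e (z, p - 1, q, 0), u]"
    have "row_record e ?d x p q" unfolding row_record_def
    proof (intro conjI allI impI)
      fix i j assume "block x p q i j"
      then have ij: "i \<in> {2 ^ p..a}" "j \<in> {2 ^ q..b}" by (auto simp: block)
      have "u < j" using c ij by (auto simp: cut_rows_def)
      show "\<exists>y\<in>X. \<exists>i' j'. ?d ! (if i < ?d ! 1 then 2 else 3) = e (y, p - 1, q, 0) \<and> ?d ! 4 \<le> j \<and>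
        i' = (if i < ?d ! 1 then ?d ! 1 - i else i - ?d ! 1 + 1) \<and> j' = j - ?d ! 4 \<and>
        i' \<in> {1..R y} \<and> i' < 2 ^ p \<and> j' \<in> {1..C y} \<and> acc x i j = acc y i' j'"
      proof (cases "i \<le> t")
        case True
        then have "t + 1 - i \<le> R y \<and> j - u \<le> C y \<and> acc x i j = acc y (t + 1 - i) (j - u)"
          using c ij by (auto simp: cut_rows_def)
        moreover have "t + 1 - i < 2 ^ p" using t ge ij by auto
        ultimately show ?thesis using True \<open>u < j\<close> X by (intro bexI[of _ y]) auto
      next
        case False
        then have "i - t \<le> R z \<and> j - u \<le> C z \<and> acc x i j = acc z (i - t) (j - u)"
          using c ij by (auto simp: cut_rows_def)
        moreover have "i - t < 2 ^ p" using t ge ij by auto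
        moreover have "i - (t + 1) + 1 = i - t" using False by auto
        ultimately show ?thesis using False \<open>u < j\<close> X by (intro bexI[of _ z]) auto
      qed
    qed (use p in auto)
    moreover have "e (y, p - 1, q, 0) < 2 ^ w" "e (z, p - 1, q, 0) < 2 ^ w" using X pq by (auto intro: e)
    ultimately show ?thesis using t ge le_w u by (intro exI[of _ ?d]) auto
  next
    fix t u y z assume t: "2 ^ q \<le> t" "t < b" and c: "cut_cols x {2 ^ p..a} {2 ^ q..b} t u y z"
    have q: "0 < q" using t ge by (cases q) auto
    have u: "u < 2 ^ p" using c ge by (auto simp: cut_cols_def)
    have X: "y \<in> X" "z \<in> X" using c by (auto simp: cut_cols_def)
    let ?d = "[4, t + 1, e (y, p, q - 1, 0), e (z, p, q - 1, 0), u]"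
    have "col_record e ?d x p q" unfolding col_record_def
    proof (intro conjI allI impI)
      fix i j assume "block x p q i j"
      then have ij: "i \<in> {2 ^ p..a}" "j \<in> {2 ^ q..b}" by (auto simp: block)
      have "u < i" using c ij by (auto simp: cut_cols_def)
      show "\<exists>y\<in>X. \<exists>i' j'. ?d ! (if j < ?d ! 1 then 2 else 3) = e (y, p, q - 1, 0) \<and> ?d ! 4 \<le> i \<and>
        j' = (if j < ?d ! 1 then ?d ! 1 - j else j - ?d ! 1 + 1) \<and> i' = i - ?d ! 4 \<and>
        i' \<in> {1..R y} \<and> j' < 2 ^ q \<and> j' \<in> {1..C y} \<and> acc x i j = acc y i' j'"
      proof (cases "j \<le> t")
        case True
        then have "t + 1 - j \<le> C y \<and> i - u \<le> R y \<and> acc x i j = acc y (i - u) (t + 1 - j)"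
          using c ij by (auto simp: cut_cols_def)
        moreover have "t + 1 - j < 2 ^ q" using t ge ij by auto
        ultimately show ?thesis using True \<open>u < i\<close> X by (intro bexI[of _ y]) auto
      next
        case False
        then have "j - t \<le> C z \<and> i - u \<le> R z \<and> acc x i j = acc z (i - u) (j - t)"
          using c ij by (auto simp: cut_cols_def)
        moreover have "j - t < 2 ^ q" using t ge ij by auto
        moreover have "j - (t + 1) + 1 = j - t" using False by auto
        ultimately show ?thesis using False \<open>u < i\<close> X by (intro bexI[of _ z]) auto
      qed
    qed (use q in auto)
    moreover have "e (y, p, q - 1, 0) < 2 ^ w" "e (z, p, q - 1, 0) < 2 ^ w" using X pq by (auto intro: e)
    ultimately show ?thesis using t ge le_w u by (intro exI[of _ ?d]) auto
  qed
qed

text \<open>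
  The last component of a state is its phase: 0 compares \<open>i\<close> with \<open>2 ^ p\<close>, 1 compares \<open>j\<close> with
  \<open>2 ^ q\<close>, and 2, reached only for positions in the block, jumps to a child.
\<close>

definition states :: "nat \<Rightarrow> ('x \<times> nat \<times> nat \<times> nat) set" where
  "states L = X \<times> {..L} \<times> {..L} \<times> {..2}"

text \<open>Induction on \<open>p + q\<close>: at most three visits, one per phase, lower the sum by
  one, and the final 3 pay for the round that ends in a leaf record.\<close>

lemma descend:
  assumes w: "L < w" and len: "length D \<le> 2 ^ w" and D: "set D \<subseteq> {..<2 ^ w}"
    and e: "\<And>s. s \<in> states L \<Longrightarrow> e s + 4 < length D"
    and ph0: "\<And>x p q m. x \<in> X \<Longrightarrow> p \<le> L \<Longrightarrow> q \<le> L \<Longrightarrow> m < 5 \<Longrightarrow> D ! (e (x, p, q, 0) + m) =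
      [1, 2 ^ p, e (x, p - 1, q, 0), e (x, p, q, 1), 0] ! m"
    and ph1: "\<And>x p q m. x \<in> X \<Longrightarrow> p \<le> L \<Longrightarrow> q \<le> L \<Longrightarrow> m < 5 \<Longrightarrow> D ! (e (x, p, q, 1) + m) =
      [2, 2 ^ q, e (x, p, q - 1, 0), e (x, p, q, 2), 0] ! m"
    and ph2: "\<And>x p q m. x \<in> X \<Longrightarrow> p \<le> L \<Longrightarrow> q \<le> L \<Longrightarrow> m < 5 \<Longrightarrow> D ! (e (x, p, q, 2) + m) =
      d x p q ! m"
    and d: "\<And>x p q. x \<in> X \<Longrightarrow> p \<le> L \<Longrightarrow> q \<le> L \<Longrightarrow>
      leaf_record (d x p q) x p q \<or> row_record e (d x p q) x p q \<or> col_record e (d x p q) x p q"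
  shows "x \<in> X \<Longrightarrow> p \<le> L \<Longrightarrow> q \<le> L \<Longrightarrow> i \<in> {1..R x} \<Longrightarrow> i < 2 ^ (p + 1) \<Longrightarrow>
    j \<in> {1..C x} \<Longrightarrow> j < 2 ^ (q + 1) \<Longrightarrow>
    answers w D (e (x, p, q, 0)) i j (3 * (p + q) + 3) (acc x i j)"
proof (induction "p + q" arbitrary: x p q i j rule: less_induct)
  case less
  note x = less.prems(1) and p = less.prems(2) and q = less.prems(3)
  have st: "(x, p, q, k) \<in> states L" if "k \<le> 2" for k
    using that x p q by (simp add: states_def)
  have s0: "e (x, p, q, 0) + 4 < length D" and s1: "e (x, p, q, 1) + 4 < length D"
    and s2: "e (x, p, q, 2) + 4 < length D"
    using e st by (meson e st order.refl zero_le one_le_numeral)+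
  have "(2::nat) ^ (p + 1) \<le> 2 ^ w" "(2::nat) ^ (q + 1) \<le> 2 ^ w"
    using p q w by - (rule power_increasing; simp)+
  then have ij: "i < 2 ^ w" "j < 2 ^ w" using less.prems by linarith+
  have Dw: "D ! a < 2 ^ w" if "a < length D" for a using D that by (meson nth_mem lessThan_iff subsetD)
  have r0: "D ! e (x, p, q, 0) = 1" "D ! (e (x, p, q, 0) + 1) = 2 ^ p"
    "D ! (e (x, p, q, 0) + 2) = e (x, p - 1, q, 0)" "D ! (e (x, p, q, 0) + 3) = e (x, p, q, 1)"
    using ph0[OF x p q, of 0] ph0[OF x p q, of 1] ph0[OF x p q, of 2] ph0[OF x p q, of 3] by simp_all
  have r1: "D ! e (x, p, q, 1) = 2" "D ! (e (x, p, q, 1) + 1) = 2 ^ q"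
    "D ! (e (x, p, q, 1) + 2) = e (x, p, q - 1, 0)" "D ! (e (x, p, q, 1) + 3) = e (x, p, q, 2)"
    using ph1[OF x p q, of 0] ph1[OF x p q, of 1] ph1[OF x p q, of 2] ph1[OF x p q, of 3] by simp_all
  let ?d = "d x p q"
  have r2: "D ! e (x, p, q, 2) = ?d ! 0" "D ! (e (x, p, q, 2) + 1) = ?d ! 1"
    "D ! (e (x, p, q, 2) + 2) = ?d ! 2" "D ! (e (x, p, q, 2) + 3) = ?d ! 3"
    "D ! (e (x, p, q, 2) + 4) = ?d ! 4"
    using ph2[OF x p q, of 0] ph2[OF x p q, of 1] ph2[OF x p q, of 2] ph2[OF x p q, of 3]
      ph2[OF x p q, of 4] by simp_all
  have d1: "?d ! 1 < 2 ^ w" using Dw[of "e (x, p, q, 2) + 1"] s2 r2 by simp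
  \<comment> \<open>A jump costs one visit and lowers \<open>p + q\<close> by one; the bound leaves
    two visits for the tests of phases 0 and 1.\<close>
  have jump: "answers w D (e (x, p, q, 2)) i j (3 * (p + q) + 1) (acc x i j)"
    if blk: "block x p q i j"
    using d[OF x p q]
  proof (elim disjE)
    assume "leaf_record ?d x p q"
    then have "answers w D (e (x, p, q, 2)) i j 1 (acc x i j)"
      using answers_leaf[OF s2 len, of i j] r2 blk by (simp add: leaf_record_def)
    then show ?thesis by (rule answers_mono) simp
  next
    assume r: "row_record e ?d x p q"
    then obtain y i' j' where y: "y \<in> X" "?d ! (if i < ?d ! 1 then 2 else 3) = e (y, p - 1, q, 0)"
      "?d ! 4 \<le> j" "i' = (if i < ?d ! 1 then ?d ! 1 - i else i - ?d ! 1 + 1)" "j' = j - ?d ! 4"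
      "i' \<in> {1..R y}" "i' < 2 ^ p" "j' \<in> {1..C y}" "acc x i j = acc y i' j'"
      using blk unfolding row_record_def by blast
    have d: "?d ! 0 = 3" "0 < ?d ! 1" "0 < p" using r by (auto simp: row_record_def)
    have IH: "answers w D (e (y, p - 1, q, 0)) i' j' (3 * (p - 1 + q) + 3) (acc y i' j')"
    proof (rule less.hyps)
      \<comment> \<open>Subtracting the offset does not enlarge \<open>j\<close>, so scale
        \<open>q\<close> remains valid.\<close>
      show "j' < 2 ^ (q + 1)" using y(5) less.prems(7) by linarith
      show "i' < 2 ^ (p - 1 + 1)" using y(7) d(3) by simp
    qed (use y(1,6,8) d(3) p q in \<open>simp_all del: atLeastAtMost_iff\<close>)
    have "answers w D (e (x, p, q, 2)) i j (Suc (3 * (p - 1 + q) + 3)) (acc y i' j')"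
      using IH y(2-5) d d1 ij r2
      by (intro answers_row[OF s2 len]) (auto split: if_splits)
    then show ?thesis using d(3) y(9) by (simp add: algebra_simps answers_mono)
  next
    assume r: "col_record e ?d x p q"
    then obtain y i' j' where y: "y \<in> X" "?d ! (if j < ?d ! 1 then 2 else 3) = e (y, p, q - 1, 0)"
      "?d ! 4 \<le> i" "j' = (if j < ?d ! 1 then ?d ! 1 - j else j - ?d ! 1 + 1)" "i' = i - ?d ! 4"
      "i' \<in> {1..R y}" "j' < 2 ^ q" "j' \<in> {1..C y}" "acc x i j = acc y i' j'"
      using blk unfolding col_record_def by blast
    have d: "?d ! 0 = 4" "0 < ?d ! 1" "0 < q" using r by (auto simp: col_record_def)
    have IH: "answers w D (e (y, p, q - 1, 0)) i' j' (3 * (p + (q - 1)) + 3) (acc y i' j')"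
    proof (rule less.hyps)
      show "i' < 2 ^ (p + 1)" using y(5) less.prems(5) by linarith
      show "j' < 2 ^ (q - 1 + 1)" using y(7) d(3) by simp
    qed (use y(1,6,8) d(3) p q in \<open>simp_all del: atLeastAtMost_iff\<close>)
    have "answers w D (e (x, p, q, 2)) i j (Suc (3 * (p + (q - 1)) + 3)) (acc y i' j')"
      using IH y(2-5) d d1 ij r2
      by (intro answers_col[OF s2 len]) (auto split: if_splits)
    then show ?thesis using d(3) y(9) by (simp add: algebra_simps answers_mono)
  qed
  \<comment> \<open>The outcomes of the tests: the row scale is too large, only the column scale is
    too large, or the block has been found.\<close>
  consider "i < 2 ^ p" | "2 ^ p \<le> i" "j < 2 ^ q" | "block x p q i j"
    using less.prems by (fastforce simp: block_def not_less)
  then show ?case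
  proof cases
    case 1
    \<comment> \<open>At scale 0 the test fails, since positions are at least 1.\<close>
    then have "0 < p" using less.prems by (cases p) auto
    then have "answers w D (e (x, p - 1, q, 0)) i j (3 * (p - 1 + q) + 3) (acc x i j)"
      using less.hyps[of "p - 1" q x i j] less.prems 1 by auto
    then have "answers w D (e (x, p, q, 0)) i j (Suc (3 * (p - 1 + q) + 3)) (acc x i j)"
      using 1 r0 by (intro answers_test_row[OF s0 len]) auto
    then show ?thesis using \<open>0 < p\<close> by (elim answers_mono) simp
  next
    case 2
    then have "0 < q" using less.prems by (cases q) auto
    then have "answers w D (e (x, p, q - 1, 0)) i j (3 * (p + (q - 1)) + 3) (acc x i j)"
      using less.hyps[of p "q - 1" x i j] less.prems 2 by auto
    then have "answers w D (e (x, p, q, 1)) i j (Suc (3 * (p + (q - 1)) + 3)) (acc x i j)"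
      using 2 r1 by (intro answers_test_col[OF s1 len]) auto
    then have "answers w D (e (x, p, q, 0)) i j (Suc (Suc (3 * (p + (q - 1)) + 3))) (acc x i j)"
      using 2 r0 by (intro answers_test_row[OF s0 len]) auto
    then show ?thesis using \<open>0 < q\<close> by (elim answers_mono) simp
  next
    case 3
    then have b: "\<not> i < 2 ^ p" "\<not> j < 2 ^ q" by (auto simp: block_def)
    have "answers w D (e (x, p, q, 1)) i j (Suc (3 * (p + q) + 1)) (acc x i j)"
      using b r1 jump[OF 3] by (intro answers_test_col[OF s1 len]) auto
    then have "answers w D (e (x, p, q, 0)) i j (Suc (Suc (3 * (p + q) + 1))) (acc x i j)"
      using b r0 by (intro answers_test_row[OF s0 len]) auto
    then show ?thesis by (simp add: numeral_3_eq_3)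
  qed
qed

text \<open>15 is five words for each of three phases, and \<open>(L + 1)\<^sup>2\<close> counts the
  pairs of scales. The descent starts at scales \<open>(L, L)\<close>, which cover all of
  \<open>x0\<close>; \<open>6 * L + 3\<close> is \<open>3 * (L + L) + 3\<close>.\<close>

theorem lookup_structure:
  assumes x0: "x0 \<in> X" "R x0 < 2 ^ (L + 1)" "C x0 < 2 ^ (L + 1)"
    and w: "L < w" "15 * card X * (L + 1)\<^sup>2 \<le> 2 ^ w"
    and acc: "\<And>x i j. x \<in> X \<Longrightarrow> i \<in> {1..R x} \<Longrightarrow> j \<in> {1..C x} \<Longrightarrow> acc x i j < 2 ^ w"
  shows "\<exists>D. length D = 15 * card X * (L + 1)\<^sup>2 \<and> set D \<subseteq> {..<2 ^ w} \<and>
    (\<forall>i\<in>{1..R x0}. \<forall>j\<in>{1..C x0}. answers w D 0 i j (6 * L + 3) (acc x0 i j))"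
proof -
  have fin: "finite (states L)" using finite_X by (simp add: states_def)
  have card: "5 * card (states L) = 15 * card X * (L + 1)\<^sup>2"
    by (simp add: states_def card_cartesian_product power2_eq_square algebra_simps)
  have q0: "(x0, L, L, 0) \<in> states L" using x0 by (simp add: states_def)
  obtain e where e0: "e (x0, L, L, 0) = 0"
    and e: "\<forall>s\<in>states L. e s + 4 < 5 * card (states L)"
    and layout: "\<forall>f. (\<forall>s\<in>states L. length (f s) = 5) \<longrightarrow>
       (\<exists>D. length D = 5 * card (states L) \<and> (\<forall>s\<in>states L. \<forall>m<5. D ! (e s + m) = f s ! m) \<and>
           set D \<subseteq> (\<Union>s\<in>states L. set (f s) :: nat set))"
    using record_layout[OF fin q0] .
  have ew: "e (x, p, q, k) < 2 ^ w" if "x \<in> X" "p \<le> L" "q \<le> L" "k \<le> 2" for x p q k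
    using bspec[OF e, of "(x, p, q, k)"] that card w(2) by (simp add: states_def)
  have w3: "3 \<le> w"
  proof (rule ccontr)
    assume "\<not> 3 \<le> w"
    then have "(2::nat) ^ w \<le> 2 ^ 2" by (intro power_increasing) auto
    then show False
      using bspec[OF e q0] card w(2) by simp
  qed
  define d where "d x p q = (SOME d. length d = 5 \<and> set d \<subseteq> {..<2 ^ w} \<and>
    (leaf_record d x p q \<or> row_record e d x p q \<or> col_record e d x p q))" for x p q
  have d: "length (d x p q) = 5 \<and> set (d x p q) \<subseteq> {..<2 ^ w} \<and>
    (leaf_record (d x p q) x p q \<or> row_record e (d x p q) x p q \<or> col_record e (d x p q) x p q)"
    if "x \<in> X" "p \<le> L" "q \<le> L" for x p q
    unfolding d_def using ew acc w(1) w3 that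
    by (intro someI_ex[OF block_record_exists[where L = L]]) auto
  \<comment> \<open>For \<open>p = 0\<close> or \<open>q = 0\<close> the truncated predecessor makes
    the record point to phase 0 at the same scales: a valid address, never followed because
    positions are at least 1.\<close>
  define f where "f = (\<lambda>(x, p, q, k :: nat).
    if k = 0 then [1, 2 ^ p, e (x, p - 1, q, 0), e (x, p, q, 1), 0]
    else if k = 1 then [2, 2 ^ q, e (x, p, q - 1, 0), e (x, p, q, 2), 0]
    else d x p (q::nat) :: nat list)"
  have fs: "length (f s) = 5 \<and> set (f s) \<subseteq> {..<2 ^ w}" if st: "s \<in> states L" for s
  proof -
    obtain x p q k where s: "s = (x, p, q, k)" "x \<in> X" "p \<le> L" "q \<le> L" "k \<le> 2"
      using st by (auto simp: states_def)
    have "(2::nat) ^ 3 \<le> 2 ^ w" using w3 by (rule power_increasing) simp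
    then show ?thesis using s d[of x p q] ew w(1) by (auto simp: f_def)
  qed
  then obtain D where D: "length D = 5 * card (states L)"
    "\<And>s m. s \<in> states L \<Longrightarrow> m < 5 \<Longrightarrow> D ! (e s + m) = f s ! m"
    "set D \<subseteq> (\<Union>s\<in>states L. set (f s) :: nat set)"
    using layout[rule_format, of f] by blast
  have Dw: "set D \<subseteq> {..<2 ^ w}" using D(3) fs by blast
  have "answers w D (e (x0, L, L, 0)) i j (3 * (L + L) + 3) (acc x0 i j)"
    if "i \<in> {1..R x0}" "j \<in> {1..C x0}" for i j
  proof (rule descend[where L = L and d = d])
    show "length D \<le> 2 ^ w" using D(1) card w(2) by simp
    show "e s + 4 < length D" if "s \<in> states L" for s using bspec[OF e that] D(1) by simp
    show "leaf_record (d x p q) x p q \<or> row_record e (d x p q) x p q \<or> col_record e (d x p q) x p q"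
      if "x \<in> X" "p \<le> L" "q \<le> L" for x p q using d that by blast
  qed (use that x0 w Dw D(2) in \<open>auto simp: states_def f_def\<close>)
  then show ?thesis using e0 D(1) card Dw by (intro exI[of _ D]) auto
qed

end

section \<open>Oriented expansions of a 2D SLP\<close>

text \<open>Without rows the width would not be determined, as \<open>ncols\<close> inspects the
  head.\<close>

lemma strings2d_dims:
  assumes "M \<in> strings2d \<Sigma> r c" "0 < r"
  shows "nrows M = r" "ncols M = c"
proof -
  have "hd M \<in> set M" using assms by (auto simp: strings2d_def)
  then show "nrows M = r" "ncols M = c"
    using assms by (simp_all add: strings2d_def nrows_def ncols_def)
qed

section \<open>Existence, uniqueness and shape of expansions\<close>

context
  fixes G :: "'s slp2d"
  assumes slp: "is_slp2d G"
begin

lemma slp_disjoint: "lits G \<inter> hors G = {}" "lits G \<inter> vers G = {}" "hors G \<inter> vers G = {}"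
  and slp_start: "start G \<in> nonterms G"
  and slp_finite: "finite (nonterms G)"
  using slp by (simp_all add: is_slp2d_def nonterms_def)

lemma slp_lit: "\<forall>N \<in> lits G. \<exists>a \<in> sigma G. rhs G N = [a]"
  and slp_bin: "\<forall>N \<in> hors G \<union> vers G. \<exists>A \<in> nonterms G. \<exists>B \<in> nonterms G. rhs G N = [A, B]"
  and slp_order: "\<exists>Ns. distinct Ns \<and> set Ns = nonterms G \<and>
        (\<forall>i < length Ns. Ns ! i \<in> hors G \<union> vers G \<longrightarrow>
           set (rhs G (Ns ! i)) \<subseteq> {Ns ! j | j. i < j \<and> j < length Ns})"
  and slp_ncols: "\<forall>N \<in> hors G. \<forall>A B M M'. rhs G N = [A, B] \<and> expands G A M \<and> expands G B M'
        \<longrightarrow> ncols M = ncols M'"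
  and slp_nrows: "\<forall>N \<in> vers G. \<forall>A B M M'. rhs G N = [A, B] \<and> expands G A M \<and> expands G B M'
        \<longrightarrow> nrows M = nrows M'"
  using slp unfolding is_slp2d_def by - (elim conjE, assumption)+

text \<open>Disjointness of the three classes of nonterminals determines the last rule of any
  derivation.\<close>

lemma expands_unique: "expands G N M \<Longrightarrow> expands G N M' \<Longrightarrow> M = M'"
proof (induction arbitrary: M' rule: expands.induct)
  case (lit N a)
  from lit(3) show ?case using lit(1,2) slp_disjoint by cases auto
next
  case (hor N A B M1 M2)
  from hor(7) show ?case using hor(1,2) hor(5,6) slp_disjoint by cases auto
next
  case (ver N A B M1 M2)
  from ver(7) show ?case using ver(1,2) ver(5,6) slp_disjoint by cases auto
qed

text \<open>Right-hand sides refer only to later positions of the ordering, so the induction runs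
  from its end.\<close>

lemma expands_exists:
  assumes "N \<in> nonterms G" shows "\<exists>M. expands G N M"
proof -
  obtain Ns where Ns: "distinct Ns" "set Ns = nonterms G"
    "\<And>i. i < length Ns \<Longrightarrow> Ns ! i \<in> hors G \<union> vers G \<Longrightarrow>
           set (rhs G (Ns ! i)) \<subseteq> {Ns ! j | j. i < j \<and> j < length Ns}"
    using slp_order by blast
  have "\<exists>M. expands G (Ns ! i) M" if "i < length Ns" for i
    using that
  proof (induction "length Ns - i" arbitrary: i rule: less_induct)
    case less
    have "Ns ! i \<in> nonterms G" using less.prems Ns(2) nth_mem by blast
    then consider "Ns ! i \<in> lits G" | "Ns ! i \<in> hors G \<union> vers G" by (auto simp: nonterms_def)
    then show ?case
    proof cases
      case 1
      then obtain a where "rhs G (Ns ! i) = [a]" using slp_lit by blast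
      then show ?thesis using expands.lit[OF 1] by metis
    next
      case 2
      then obtain A B where AB: "rhs G (Ns ! i) = [A, B]" using slp_bin by blast
      have "\<exists>M. expands G K M" if "K \<in> set (rhs G (Ns ! i))" for K
      proof -
        obtain j where "K = Ns ! j" "i < j" "j < length Ns" using Ns(3)[OF less.prems 2] \<open>K \<in> _\<close> by auto
        then show ?thesis using less.hyps[of j] by auto
      qed
      from this[of A] this[of B] obtain M M' where "expands G A M" "expands G B M'"
        using AB by auto
      then show ?thesis using 2 AB expands.hor expands.ver by (metis Un_iff)
    qed
  qed
  then show ?thesis using assms Ns(2) by (metis in_set_conv_nth)
qed

definition expansion :: "'s \<Rightarrow> 's list list" where
  "expansion N = (THE M. expands G N M)"

lemma expansion_eq: "expands G N M \<Longrightarrow> expansion N = M"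
  unfolding expansion_def using expands_unique by blast

lemma expands_expansion: "N \<in> nonterms G \<Longrightarrow> expands G N (expansion N)"
  using expands_exists expansion_eq by blast

lemma expands_strings2d:
  "expands G N M \<Longrightarrow> M \<in> strings2d (sigma G) (nrows M) (ncols M) \<and> 0 < nrows M \<and> 0 < ncols M"
proof -
  \<comment> \<open>The induction works with unspecified dimensions, identified afterwards by
    \<open>strings2d_dims\<close>.\<close>
  have "\<exists>r c. M \<in> strings2d (sigma G) r c \<and> 0 < r \<and> 0 < c" if "expands G N M"
    using that
  proof (induction rule: expands.induct)
    case (lit N a)
    then have "a \<in> sigma G" using slp_lit by force
    then have "[[a]] \<in> strings2d (sigma G) 1 1" by (simp add: strings2d_def)
    then show ?case by (meson zero_less_one)
  next
    case (hor N A B M M')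
    then obtain r c r' c' where M: "M \<in> strings2d (sigma G) r c" "0 < r" "0 < c"
      and M': "M' \<in> strings2d (sigma G) r' c'" "0 < r'" "0 < c'" by blast
    have "ncols M = ncols M'" using slp_ncols hor by blast
    then have "c = c'" using strings2d_dims[OF M(1,2)] strings2d_dims[OF M'(1,2)] by simp
    then have "M @ M' \<in> strings2d (sigma G) (r + r') c" using M M' by (auto simp: strings2d_def)
    then show ?case using M by (meson add_pos_pos M'(2))
  next
    case (ver N A B M M')
    then obtain r c r' c' where M: "M \<in> strings2d (sigma G) r c" "0 < r" "0 < c"
      and M': "M' \<in> strings2d (sigma G) r' c'" "0 < r'" "0 < c'" by blast
    have "nrows M = nrows M'" using slp_nrows ver by blast
    then have "r = r'" using strings2d_dims[OF M(1,2)] strings2d_dims[OF M'(1,2)] by simp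
    \<comment> \<open>\<open>map2\<close> stops at the shorter list; \<open>r = r'\<close> prevents
      any loss of rows.\<close>
    then have "map2 (@) M M' \<in> strings2d (sigma G) r (c + c')" using M M'
      by (auto simp: strings2d_def elim!: in_set_zipE)
    then show ?case using M by (meson add_pos_pos M'(3))
  qed
  then show "expands G N M \<Longrightarrow> ?thesis" using strings2d_dims by metis
qed

section \<open>Oriented expansions as a grid\<close>

definition mirror :: "bool \<Rightarrow> nat \<Rightarrow> nat \<Rightarrow> nat" where
  "mirror f k i = (if f then k + 1 - i else i)"

text \<open>The flags \<open>f\<close> and \<open>g\<close> mirror rows and columns, so four copies
  of each nonterminal suffice for closure under both mirrorings.\<close>

definition oriented :: "('s \<Rightarrow> nat) \<Rightarrow> 's \<times> bool \<times> bool \<Rightarrow> nat \<Rightarrow> nat \<Rightarrow> nat" where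
  "oriented enc = (\<lambda>(N, f, g) i j. enc (access2d (expansion N)
     (mirror f (nrows (expansion N)) i) (mirror g (ncols (expansion N)) j)))"

lemma mirror_range: "i \<in> {1..k} \<Longrightarrow> mirror f k i \<in> {1..k}"
  by (auto simp: mirror_def)

lemma expansion_hor:
  assumes "N \<in> hors G" "rhs G N = [A, B]"
  shows "A \<in> nonterms G" "B \<in> nonterms G"
    "nrows (expansion N) = nrows (expansion A) + nrows (expansion B)"
    "ncols (expansion A) = ncols (expansion N)" "ncols (expansion B) = ncols (expansion N)"
    "\<And>i j. i \<in> {1..nrows (expansion N)} \<Longrightarrow> access2d (expansion N) i j =
       (if i \<le> nrows (expansion A) then access2d (expansion A) i j
        else access2d (expansion B) (i - nrows (expansion A)) j)"
proof -
  show AB: "A \<in> nonterms G" "B \<in> nonterms G" using assms slp_bin by force+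
  note E = expands_expansion[OF AB(1)] expands_expansion[OF AB(2)]
  have N: "expansion N = expansion A @ expansion B"
    using expansion_eq[OF expands.hor[OF assms E]] .
  have "ncols (expansion A) = ncols (expansion B)"
    using slp_ncols assms E by blast
  moreover have "expansion A \<noteq> []"
    using expands_strings2d[OF E(1)] by (simp flip: length_greater_0_conv add: nrows_def)
  ultimately show "nrows (expansion N) = nrows (expansion A) + nrows (expansion B)"
    "ncols (expansion A) = ncols (expansion N)" "ncols (expansion B) = ncols (expansion N)"
    by (auto simp: N nrows_def ncols_def)
  show "access2d (expansion N) i j =
       (if i \<le> nrows (expansion A) then access2d (expansion A) i j
        else access2d (expansion B) (i - nrows (expansion A)) j)"
    if "i \<in> {1..nrows (expansion N)}" for i j
    using that by (auto simp: N access2d_def nrows_def nth_append diff_diff_add add.commute)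
qed

lemma expansion_ver:
  assumes "N \<in> vers G" "rhs G N = [A, B]"
  shows "A \<in> nonterms G" "B \<in> nonterms G"
    "ncols (expansion N) = ncols (expansion A) + ncols (expansion B)"
    "nrows (expansion A) = nrows (expansion N)" "nrows (expansion B) = nrows (expansion N)"
    "\<And>i j. i \<in> {1..nrows (expansion N)} \<Longrightarrow> j \<in> {1..ncols (expansion N)} \<Longrightarrow>
       access2d (expansion N) i j =
       (if j \<le> ncols (expansion A) then access2d (expansion A) i j
        else access2d (expansion B) i (j - ncols (expansion A)))"
proof -
  show AB: "A \<in> nonterms G" "B \<in> nonterms G" using assms slp_bin by force+
  note E = expands_expansion[OF AB(1)] expands_expansion[OF AB(2)]
  have N: "expansion N = map2 (@) (expansion A) (expansion B)"
    using expansion_eq[OF expands.ver[OF assms E]] .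
  have eq: "nrows (expansion A) = nrows (expansion B)"
    using slp_nrows assms E by blast
  have "expansion A \<noteq> []" "expansion B \<noteq> []"
    using expands_strings2d[OF E(1)] expands_strings2d[OF E(2)]
    by (simp_all flip: length_greater_0_conv add: nrows_def)
  then show "ncols (expansion N) = ncols (expansion A) + ncols (expansion B)"
    by (simp add: N ncols_def hd_map hd_zip)
  show rows: "nrows (expansion A) = nrows (expansion N)" "nrows (expansion B) = nrows (expansion N)"
    using eq by (auto simp: N nrows_def)
  show "access2d (expansion N) i j =
       (if j \<le> ncols (expansion A) then access2d (expansion A) i j
        else access2d (expansion B) i (j - ncols (expansion A)))"
    if "i \<in> {1..nrows (expansion N)}" "j \<in> {1..ncols (expansion N)}" for i j
  proof -
    have i: "i - 1 < length (expansion A)" "i - 1 < length (expansion B)"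
      using that rows by (auto simp: nrows_def)
    from nth_mem[OF i(1)] have "length (expansion A ! (i - 1)) = ncols (expansion A)"
      using expands_strings2d[OF E(1)] unfolding strings2d_def by blast
    then show ?thesis using i that
      by (auto simp: N access2d_def nth_append diff_diff_add add.commute)
  qed
qed

lemma grid_oriented:
  "grid (nonterms G \<times> UNIV \<times> UNIV) (\<lambda>(N, f, g). nrows (expansion N))
     (\<lambda>(N, f, g). ncols (expansion N)) (oriented enc)"
proof
  show "finite (nonterms G \<times> (UNIV :: bool set) \<times> (UNIV :: bool set))"
    using slp_finite by simp
next
  fix x :: "'s \<times> bool \<times> bool"
  assume "x \<in> nonterms G \<times> UNIV \<times> UNIV"
  then obtain N f g where x: "x = (N, f, g)" "N \<in> nonterms G" by auto
  let ?R = "\<lambda>(N, f :: bool, g :: bool). nrows (expansion N)"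
  let ?C = "\<lambda>(N, f :: bool, g :: bool). ncols (expansion N)"
  let ?X = "nonterms G \<times> (UNIV :: bool set) \<times> (UNIV :: bool set)"
  show "0 < ?R x \<and> 0 < ?C x" using expands_strings2d[OF expands_expansion[OF x(2)]] x by simp
  show "\<exists>y\<in>?X. ?R y = ?R x \<and> ?C y = ?C x \<and> (\<forall>i\<in>{1..?R x}. \<forall>j\<in>{1..?C x}.
      oriented enc y i j = oriented enc x (?R x + 1 - i) j)"
    using x by (intro bexI[of _ "(N, \<not> f, g)"]) (auto simp: oriented_def mirror_def)
  show "\<exists>y\<in>?X. ?R y = ?R x \<and> ?C y = ?C x \<and> (\<forall>i\<in>{1..?R x}. \<forall>j\<in>{1..?C x}.
      oriented enc y i j = oriented enc x i (?C x + 1 - j))"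
    using x by (intro bexI[of _ "(N, f, \<not> g)"]) (auto simp: oriented_def mirror_def)
  let ?rows = "\<exists>y\<in>?X. \<exists>z\<in>?X. ?R x = ?R y + ?R z \<and> ?C y = ?C x \<and> ?C z = ?C x \<and>
    (\<forall>i\<in>{1..?R x}. \<forall>j\<in>{1..?C x}. oriented enc x i j =
       (if i \<le> ?R y then oriented enc y i j else oriented enc z (i - ?R y) j))"
  let ?cols = "\<exists>y\<in>?X. \<exists>z\<in>?X. ?C x = ?C y + ?C z \<and> ?R y = ?R x \<and> ?R z = ?R x \<and>
    (\<forall>i\<in>{1..?R x}. \<forall>j\<in>{1..?C x}. oriented enc x i j =
       (if j \<le> ?C y then oriented enc y i j else oriented enc z i (j - ?C y)))"
  consider "N \<in> lits G" | "N \<in> hors G" | "N \<in> vers G" using x(2) by (auto simp: nonterms_def)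
  then show "(?R x = 1 \<and> ?C x = 1) \<or> ?rows \<or> ?cols"
  proof cases
    case 1
    then obtain a where "rhs G N = [a]" using slp_lit by blast
    then have "expansion N = [[a]]" using expansion_eq[OF expands.lit[OF 1]] by metis
    then show ?thesis using x by (simp add: nrows_def ncols_def)
  next
    case 2
    then obtain A B where AB: "rhs G N = [A, B]" using slp_bin by blast
    note E = expansion_hor[OF 2 AB]
    \<comment> \<open>Mirroring the rows puts \<open>B\<close> above \<open>A\<close>; both parts
      inherit the flags.\<close>
    let ?y = "(if f then B else A, f, g)" and ?z = "(if f then A else B, f, g)"
    have "oriented enc x i j =
       (if i \<le> ?R ?y then oriented enc ?y i j else oriented enc ?z (i - ?R ?y) j)"
      if "i \<in> {1..?R x}" "j \<in> {1..?C x}" for i j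
      using that E(3-6) x mirror_range[of i "?R x" f]
      by (auto simp: oriented_def mirror_def)
    then have ?rows using E(1-5) x by (intro bexI[of _ ?y] bexI[of _ ?z]) auto
    then show ?thesis by blast
  next
    case 3
    then obtain A B where AB: "rhs G N = [A, B]" using slp_bin by blast
    note E = expansion_ver[OF 3 AB]
    let ?y = "(if g then B else A, f, g)" and ?z = "(if g then A else B, f, g)"
    have "oriented enc x i j =
       (if j \<le> ?C ?y then oriented enc ?y i j else oriented enc ?z i (j - ?C ?y))"
      if "i \<in> {1..?R x}" "j \<in> {1..?C x}" for i j
      using that E(3-6) x mirror_range[of i "?R x" f] mirror_range[of j "?C x" g]
      by (auto simp: oriented_def mirror_def)
    then have ?cols using E(1-5) x by (intro bexI[of _ ?y] bexI[of _ ?z]) auto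
    then show ?thesis by blast
  qed
qed

section \<open>Word bounds, size and the initial configuration\<close>

lemma oriented_less:
  assumes "enc ` sigma G \<subseteq> {..<K}" "N \<in> nonterms G"
    "i \<in> {1..nrows (expansion N)}" "j \<in> {1..ncols (expansion N)}"
  shows "oriented enc (N, f, g) i j < K"
proof -
  let ?M = "expansion N" and ?i = "mirror f (nrows (expansion N)) i"
    and ?j = "mirror g (ncols (expansion N)) j"
  have ij: "?i \<in> {1..nrows ?M}" "?j \<in> {1..ncols ?M}" using assms mirror_range by auto
  have M: "?M \<in> strings2d (sigma G) (nrows ?M) (ncols ?M)"
    using expands_strings2d[OF expands_expansion[OF assms(2)]] by blast
  have "?M ! (?i - 1) \<in> set ?M" using ij by (intro nth_mem) (auto simp: nrows_def)
  then have "length (?M ! (?i - 1)) = ncols ?M" "set (?M ! (?i - 1)) \<subseteq> sigma G"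
    using M unfolding strings2d_def by blast+
  moreover from this have "?M ! (?i - 1) ! (?j - 1) \<in> set (?M ! (?i - 1))"
    using ij by (intro nth_mem) auto
  ultimately show ?thesis using assms(1) by (auto simp: oriented_def access2d_def)
qed

lemma card_nonterms_le: "card (nonterms G) \<le> slp_size G"
proof -
  have "(\<Sum>N\<in>nonterms G. 1) \<le> slp_size G" unfolding slp_size_def by (intro sum_mono) simp
  then show ?thesis by simp
qed

end

text \<open>The extra operation loads the constant 1, which needs \<open>0 < w\<close> to survive
  the reduction. The initial 0 in register 2 selects the start state.\<close>

lemma query_answer_lookup_prog:
  assumes "answers w D 0 i j n v" "0 < w"
  shows "\<exists>t \<le> 25 * n + 1. query_answer w lookup_prog D i j t v"
proof -
  let ?R = "((\<lambda>_. 0)(0 := i, 1 := j, 3 := 1)) :: nat \<Rightarrow> nat"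
  obtain t pc R' where t: "t \<le> 25 * n" "steps w lookup_prog t (1, ?R, D) = Some (pc, R', D)"
    "pc < length lookup_prog" "lookup_prog ! pc = Halt" "R' 0 = v"
    using assms(1)[unfolded answers_def, rule_format, of ?R] by auto
  have "step w lookup_prog (0, (\<lambda>_. 0)(0 := i, 1 := j), D) = Some (1, ?R, D)"
    using assms(2) by (simp add: step_def lookup_prog_def)
  then have "steps w lookup_prog (Suc t) (0, (\<lambda>_. 0)(0 := i, 1 := j), D) = Some (pc, R', D)"
    using t(2) by simp
  then show ?thesis using t unfolding query_answer_def by (intro exI[of _ "Suc t"]) auto
qed

theorem theorem6p9:
  "\<exists>(P :: instr list) (Cs :: real) (Ct :: real).
     \<forall>(G :: 's slp2d) T r c w (enc :: 's \<Rightarrow> nat).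
       is_slp2d G \<and> represents G T \<and> T \<in> strings2d (sigma G) r c \<and>
       max r c < 2 ^ w \<and> Cs * real (slp_size G) * lg (max r c) ^ 2 \<le> 2 ^ w \<and>
       inj_on enc (sigma G) \<and> enc ` sigma G \<subseteq> {..<2 ^ w} \<longrightarrow>
       (\<exists>D. set D \<subseteq> {..<2 ^ w} \<and>
          real (length D) \<le> Cs * real (slp_size G) * lg (max r c) ^ 2 \<and>
          (\<forall>i \<in> {1..r}. \<forall>j \<in> {1..c}.
             \<exists>t. real t \<le> Ct * lg (max r c) \<and>
                 query_answer w P D i j t (enc (access2d T i j))))"
\<comment> \<open>240 is 15 words, times four orientations, times 4 from
  \<open>L + 1 \<le> 2 * lg ?n\<close>. The time \<open>25 * (6 * L + 3) + 1 = 150 * L + 76\<close>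
  is below \<open>300 * lg ?n\<close>.\<close>
proof (rule exI[of _ lookup_prog], rule exI[of _ 240], rule exI[of _ 300],
    intro allI impI, elim conjE)
  fix G :: "'s slp2d" and T and r c w :: nat and enc :: "'s \<Rightarrow> nat"
  let ?n = "max r c"
  assume G: "is_slp2d G" and T: "represents G T" "T \<in> strings2d (sigma G) r c" and n: "?n < 2 ^ w"
    and space: "240 * real (slp_size G) * lg ?n ^ 2 \<le> 2 ^ w" and enc: "enc ` sigma G \<subseteq> {..<2 ^ w}"
  let ?S = "start G"
  have S: "?S \<in> nonterms G" using slp_start[OF G] .
  have TS: "expansion G ?S = T" using expansion_eq[OF G] T(1) by (simp add: represents_def)
  have "0 < nrows T" using expands_strings2d[OF G] T(1) by (simp add: represents_def)
  then have "0 < r" using T(2) by (auto simp: strings2d_def nrows_def)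
  note dims = strings2d_dims[OF T(2) this] this
  \<comment> \<open>\<open>L\<close> is the integer part of the binary logarithm, so scales up to
    \<open>L\<close> cover all positions.\<close>
  obtain L where L: "2 ^ L \<le> ?n" "?n < 2 ^ (L + 1)"
    using ex_power_ivl1[of 2 ?n] dims(3) by fastforce
  have "(2::nat) ^ L < 2 ^ w" using L(1) n by linarith
  then have Lw: "L < w" by simp
  have "real L \<le> log 2 (real ?n)"
    using L(1) dims(3) by (intro le_log_of_power) (auto simp flip: of_nat_le_iff)
  then have lg: "real L \<le> lg ?n" "1 \<le> lg ?n" by (auto simp: lg_def)
  let ?X = "nonterms G \<times> (UNIV :: bool set) \<times> (UNIV :: bool set)"
  have card: "card ?X = 4 * card (nonterms G)" by (simp add: card_cartesian_product del: UNIV_Times_UNIV)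
  have "(real L + 1)\<^sup>2 \<le> (2 * lg ?n)\<^sup>2" using lg by (intro power_mono) auto
  then have "60 * real (card (nonterms G)) * (real L + 1)\<^sup>2 \<le> 60 * real (slp_size G) * (2 * lg ?n)\<^sup>2"
    using card_nonterms_le[OF G] by (intro mult_mono) auto
  then have size: "real (15 * card ?X * (L + 1)\<^sup>2) \<le> 240 * real (slp_size G) * (lg ?n)\<^sup>2"
    unfolding card by (simp add: power_mult_distrib add.commute)
  then have "real (15 * card ?X * (L + 1)\<^sup>2) \<le> real (2 ^ w)" using space by simp
  then have fits: "15 * card ?X * (L + 1)\<^sup>2 \<le> 2 ^ w" by (simp only: of_nat_le_iff)
  have "\<exists>D. length D = 15 * card ?X * (L + 1)\<^sup>2 \<and> set D \<subseteq> {..<2 ^ w} \<and>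
    (\<forall>i\<in>{1..r}. \<forall>j\<in>{1..c}. answers w D 0 i j (6 * L + 3) (oriented G enc (?S, False, False) i j))"
    using grid.lookup_structure[OF grid_oriented[OF G, of enc], of "(?S, False, False)" L w]
      S TS dims L(2) Lw fits oriented_less[OF G enc] by auto
  then obtain D where D: "length D = 15 * card ?X * (L + 1)\<^sup>2" "set D \<subseteq> {..<2 ^ w}"
    "\<And>i j. i \<in> {1..r} \<Longrightarrow> j \<in> {1..c} \<Longrightarrow>
       answers w D 0 i j (6 * L + 3) (oriented G enc (?S, False, False) i j)"
    by blast
  show "\<exists>D. set D \<subseteq> {..<2 ^ w} \<and> real (length D) \<le> 240 * real (slp_size G) * lg ?n ^ 2 \<and>
          (\<forall>i \<in> {1..r}. \<forall>j \<in> {1..c}. \<exists>t. real t \<le> 300 * lg ?n \<and>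
                 query_answer w lookup_prog D i j t (enc (access2d T i j)))"
  proof (intro exI[of _ D] conjI ballI)
    show "real (length D) \<le> 240 * real (slp_size G) * lg ?n ^ 2" using D(1) size by simp
    fix i j assume "i \<in> {1..r}" "j \<in> {1..c}"
    then have "answers w D 0 i j (6 * L + 3) (enc (access2d T i j))"
      using D(3)[of i j] TS by (simp add: oriented_def[OF G] mirror_def[OF G])
    then obtain t where t: "t \<le> 25 * (6 * L + 3) + 1"
      "query_answer w lookup_prog D i j t (enc (access2d T i j))"
      using query_answer_lookup_prog[of w D i j "6 * L + 3"] Lw by force
    have "real t \<le> real (150 * L + 76)" using t(1) by (subst of_nat_le_iff) simp
    then have "real t \<le> 150 * real L + 76" by simp
    also have "\<dots> \<le> 300 * lg ?n" using lg by linarith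
    finally show "\<exists>t. real t \<le> 300 * lg ?n \<and>
      query_answer w lookup_prog D i j t (enc (access2d T i j))" using t(2) by blast
  qed (use D(2) in simp)
qed

end
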